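(* Let $Q_0\ge2$, let $\alpha=(\alpha_1,\dots,\alpha_{Q_0})$ be a probability vector with positive entries and $\pi=(\pi_{qr})_{q,r\in[Q_0]}$ a symmetric matrix with entries in $[0,1]$, such that $\overline{\pi}_q\ne\overline{\pi}_r$ whenever $q\ne r$, where $\overline{\pi}_q=\sum_r\alpha_r\pi_{qr}$. For each $n\ge 2$ let a graph be drawn from the Stochastic Block Model $\mathcal{G}(n,\pi,\alpha)$, all graphs being defined on a common probability space. Fix $\beta\in\,]0,1[$ and for $2\le Q\le n$ set $$f_Q=\sum_{q=1}^{Q-1}(H_q-G_q)+\frac{1}{n^{\frac{1-\beta}{2}}G_{Q-1}}\in[0,+\infty],$$ where $G_q=G^n_q$ are the ordered gaps between consecutive normalized degrees and $H_q=H_q^n$ are the ordered gaps between the mean normalized degrees of the classes returned by the Largest Gaps (LG) algorithm with input $Q$ (defined in the context). Then, for fixed $Q\geq 2$: 1. if $Q=Q_0$, then $f_Q\to0$ almost surely as $n\to+\infty$; 2. if $Q<Q_0$, then $\liminf_{n\to+\infty}f_Q>0$ almost surely; 3. if $Q>Q_0$, then $f_Q\to+\infty$ almost surely as $n\to+\infty$. Moreover $\widehat Q=\arg\min_{2\le Q\le n}f_Q\to Q_0$ almost surely as $n\to+\infty$.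
   Context: Notation: $[n]=\{1,\dots,n\}$; $1/0=+\infty$. Stochastic Block Model $\mathcal{G}(n,\pi,\alpha)$ with $Q_0$ classes: the labels $Z_1,\dots,Z_n$ are i.i.d. in $[Q_0]$ with $P(Z_i=q)=\alpha_q$; $X$ is the adjacency matrix of an undirected graph on $[n]$ without self-loops ($X_{ij}=X_{ji}$), and conditionally on $Z$ the variables $X_{ij}$, $i<j$, are independent, $X_{ij}$ being Bernoulli with parameter $\pi_{Z_iZ_j}$. Normalized degrees: $T_i=\frac{1}{n-1}\sum_{j\ne i}X_{ij}$, sorted as $T_{(1)}\le\dots\le T_{(n)}$ (here $(i)$ also denotes the node in position $i$). $G^n_1\ge G^n_2\ge\dots\ge G^n_{n-1}$ are the gaps $T_{(i+1)}-T_{(i)}$, $i\in[n-1]$, sorted in decreasing order. LG algorithm with input $Q$: find indices $i_1<\dots<i_{Q-1}$ in $[n-1]$ of the $Q-1$ largest gaps, i.e. $T_{(i_k+1)}-T_{(i_k)}\ge T_{(i+1)}-T_{(i)}$ for all $k\in[Q-1]$ and $i\in[n-1]\setminus\{i_1,\dots,i_{Q-1}\}$ (ties broken arbitrarily); with $i_0=0$, $i_Q=n$, the estimated class $\widehat{\mathcal{C}}_k$ is the set of nodes $(i)$ with $i_{k-1}<i\le i_k$. For given $Q$, let $m_q=\frac{1}{|\widehat{\mathcal{C}}_q|}\sum_{i\in\widehat{\mathcal{C}}_q}T_i$ for $q\in[Q]$, sorted as $m_{(1)}\le\dots\le m_{(Q)}$; $H^n_1\ge\dots\ge H^n_{Q-1}$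 are the gaps $m_{(q+1)}-m_{(q)}$, $q\in[Q-1]$, sorted in decreasing order (they depend on $Q$). *)

theory Defs
  imports "HOL-Probability.Probability"
begin

text \<open>
  Nodes are the elements of \<open>{1..n}\<close>, classes the elements of \<open>{1..Q0}\<close>. \<open>Z \<omega> i\<close> is the label of
  node \<open>i\<close> and \<open>X \<omega> i j\<close> says that \<open>{i, j}\<close> is an edge. Conditioning on the labels is
  elementary conditioning on the atoms \<open>{Z = z}\<close>, i.e. passing to \<^const>\<open>uniform_measure\<close>.
\<close>

definition label_event ::
  "'a measure \<Rightarrow> nat \<Rightarrow> ('a \<Rightarrow> nat \<Rightarrow> nat) \<Rightarrow> (nat \<Rightarrow> nat) \<Rightarrow> 'a set" where
  "label_event M n Z z = {\<omega> \<in> space M. \<forall>i\<in>{1..n}. Z \<omega> i = z i}"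

definition stochastic_block_model ::
  "'a measure \<Rightarrow> nat \<Rightarrow> nat \<Rightarrow> (nat \<Rightarrow> nat \<Rightarrow> real) \<Rightarrow> (nat \<Rightarrow> real) \<Rightarrow>
   ('a \<Rightarrow> nat \<Rightarrow> nat) \<Rightarrow> ('a \<Rightarrow> nat \<Rightarrow> nat \<Rightarrow> bool) \<Rightarrow> bool" where
  "stochastic_block_model M n Q0 \<pi> \<alpha> Z X \<longleftrightarrow>
     prob_space.indep_vars M (\<lambda>_. count_space {1..Q0}) (\<lambda>i \<omega>. Z \<omega> i) {1..n} \<and>
     (\<forall>i\<in>{1..n}. \<forall>q\<in>{1..Q0}. measure M {\<omega> \<in> space M. Z \<omega> i = q} = \<alpha> q) \<and>
     (\<forall>i\<in>{1..n}. \<forall>j\<in>{1..n}. (\<lambda>\<omega>. X \<omega> i j) \<in> measurable M (count_space UNIV)) \<and>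
     (\<forall>\<omega>\<in>space M. \<forall>i\<in>{1..n}. \<not> X \<omega> i i) \<and>
     (\<forall>\<omega>\<in>space M. \<forall>i\<in>{1..n}. \<forall>j\<in>{1..n}. X \<omega> i j = X \<omega> j i) \<and>
     (\<forall>z \<in> {1..n} \<rightarrow> {1..Q0}. measure M (label_event M n Z z) > 0 \<longrightarrow>
        prob_space.indep_vars (uniform_measure M (label_event M n Z z))
          (\<lambda>_. count_space UNIV) (\<lambda>(i, j) \<omega>. X \<omega> i j) {(i, j). 1 \<le> i \<and> i < j \<and> j \<le> n} \<and>
        (\<forall>i j. 1 \<le> i \<and> i < j \<and> j \<le> n \<longrightarrow>
          distr (uniform_measure M (label_event M n Z z)) (count_space UNIV) (\<lambda>\<omega>. X \<omega> i j)
            = measure_pmf (bernoulli_pmf (\<pi> (z i) (z j)))))"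

definition norm_degree :: "nat \<Rightarrow> (nat \<Rightarrow> nat \<Rightarrow> bool) \<Rightarrow> nat \<Rightarrow> real" where
  "norm_degree n A i = (\<Sum>j\<in>{1..n} - {i}. of_bool (A i j)) / (real n - 1)"

text \<open>
  \<open>order_stat n x k\<close> is the \<open>k\<close>-th smallest of \<open>x 1, \<dots>, x n\<close> (for \<open>1 \<le> k \<le> n\<close>), and
  \<open>largest_gap n x q\<close> is the \<open>q\<close>-th largest of the \<open>n - 1\<close> consecutive gaps, with multiplicity.
\<close>

definition order_stat :: "nat \<Rightarrow> (nat \<Rightarrow> real) \<Rightarrow> nat \<Rightarrow> real" where
  "order_stat n x k = sort (map x [1..<n + 1]) ! (k - 1)"

definition gap :: "nat \<Rightarrow> (nat \<Rightarrow> real) \<Rightarrow> nat \<Rightarrow> real" where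
  "gap n x i = order_stat n x (i + 1) - order_stat n x i"

definition largest_gap :: "nat \<Rightarrow> (nat \<Rightarrow> real) \<Rightarrow> nat \<Rightarrow> real" where
  "largest_gap n x q = rev (sort (map (gap n x) [1..<n])) ! (q - 1)"

text \<open>
  \<open>is_ranking n x \<sigma>\<close>: \<open>\<sigma> i\<close> is the node in position \<open>i\<close> when the nodes are sorted by \<open>x\<close>.
  Since both the ranking and the largest gaps may involve ties, the algorithm is a relation:
  \<open>lg_output n x Q C\<close> says that \<open>C 1, \<dots>, C Q\<close> are the estimated classes for some way of
  breaking the ties.
\<close>

definition is_ranking :: "nat \<Rightarrow> (nat \<Rightarrow> real) \<Rightarrow> (nat \<Rightarrow> nat) \<Rightarrow> bool" where
  "is_ranking n x \<sigma> \<longleftrightarrow> bij_betw \<sigma> {1..n} {1..n} \<and> mono_on {1..n} (\<lambda>i. x (\<sigma> i))"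

definition lg_indices :: "nat \<Rightarrow> (nat \<Rightarrow> real) \<Rightarrow> nat \<Rightarrow> (nat \<Rightarrow> nat) \<Rightarrow> bool" where
  "lg_indices n x Q \<iota> \<longleftrightarrow>
     \<iota> 0 = 0 \<and> \<iota> Q = n \<and> \<iota> ` {1..Q - 1} \<subseteq> {1..n - 1} \<and> strict_mono_on {1..Q - 1} \<iota> \<and>
     (\<forall>k\<in>{1..Q - 1}. \<forall>i\<in>{1..n - 1} - \<iota> ` {1..Q - 1}. gap n x (\<iota> k) \<ge> gap n x i)"

definition lg_output :: "nat \<Rightarrow> (nat \<Rightarrow> real) \<Rightarrow> nat \<Rightarrow> (nat \<Rightarrow> nat set) \<Rightarrow> bool" where
  "lg_output n x Q C \<longleftrightarrow>
     (\<exists>\<sigma> \<iota>. is_ranking n x \<sigma> \<and> lg_indices n x Q \<iota> \<and>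
        (\<forall>k\<in>{1..Q}. C k = \<sigma> ` {\<iota> (k - 1)<..\<iota> k}))"

definition class_mean :: "(nat \<Rightarrow> real) \<Rightarrow> (nat \<Rightarrow> nat set) \<Rightarrow> nat \<Rightarrow> real" where
  "class_mean x C q = (\<Sum>i\<in>C q. x i) / real (card (C q))"

text \<open>
  The criterion, for \<open>x\<close> the normalized degrees and \<open>C\<close> the estimated classes. The second
  division is the one of \<^typ>\<open>ereal\<close>, for which \<open>1 / 0 = \<infinity>\<close>.
\<close>

definition lg_criterion ::
  "real \<Rightarrow> nat \<Rightarrow> (nat \<Rightarrow> real) \<Rightarrow> nat \<Rightarrow> (nat \<Rightarrow> nat set) \<Rightarrow> ereal" where
  "lg_criterion \<beta> n x Q C =
     ereal (\<Sum>q = 1..Q - 1. largest_gap Q (class_mean x C) q - largest_gap n x q)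
     + 1 / ereal (real n powr ((1 - \<beta>) / 2) * largest_gap n x (Q - 1))"

end

theory Submission imports Defs "HOL-Real_Asymp.Real_Asymp" begin

text \<open>
  By Hoeffding's inequality, applied to the labels and, conditionally on them, to the edges, and by
  Borel-Cantelli, almost surely every normalized degree is eventually within a vanishing distance
  \<open>s n\<close> of the mean \<open>p q\<close> of its class, where \<open>s n\<close> still tends to zero after multiplication by
  \<open>n powr ((1 - \<beta>) / 2)\<close>, and every class has a positive proportion of the nodes. The rest is
  deterministic. If \<open>\<delta>\<close> is the smallest distance between two of the means \<open>p q\<close>, then exactly
  \<open>Q0 - 1\<close> gaps are at least \<open>\<delta> - 2 * s n\<close> and the others are at most \<open>2 * s n\<close>. For \<open>Q > Q0\<close> the
  penalty therefore explodes. For \<open>Q \<le> Q0\<close> the algorithm only cuts at large gaps, so the estimated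
  classes are unions of true ones, and the sum of \<open>H - G\<close> is a sum of distances between class means
  and class extremes: these vanish if all classes are recovered, and one of them stays away from
  zero if two classes are merged.
\<close>

section \<open>Order statistics and the output of the algorithm\<close>

text \<open>A sorted list is determined by its multiset, and a ranking permutes the nodes. Ties
  therefore do not matter: every ranking lists the same values.\<close>

lemma order_stat_ranking:
  assumes "is_ranking n x \<sigma>" "k \<in> {1..n}"
  shows "order_stat n x k = x (\<sigma> k)"
proof -
  have bij: "bij_betw \<sigma> {1..n} {1..n}" and mono: "mono_on {1..n} (\<lambda>i. x (\<sigma> i))"
    using assms(1) by (auto simp: is_ranking_def)
  have set: "set [1..<n + 1] = {1..n}" by auto
  have "image_mset \<sigma> (mset_set {1..n}) = mset_set {1..n}"
    using bij by (metis bij_betw_def image_mset_mset_set)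
  then have "mset (map (\<lambda>i. x (\<sigma> i)) [1..<n + 1]) = mset (map x [1..<n + 1])"
    using set by (metis (no_types, lifting) distinct_upt image_mset.compositionality comp_def
        mset_map mset_set_set multiset.map_cong0)
  moreover have "sorted (map (\<lambda>i. x (\<sigma> i)) [1..<n + 1])"
    by (auto simp: sorted_iff_nth_mono intro!: mono_onD[OF mono] simp del: upt_Suc)
  ultimately have "sort (map x [1..<n + 1]) = map (\<lambda>i. x (\<sigma> i)) [1..<n + 1]"
    by (rule properties_for_sort)
  then show ?thesis
    using assms(2) by (auto simp: order_stat_def nth_append simp del: upt_Suc)
qed

lemma ranking_mono:
  assumes "is_ranking n x \<sigma>" "1 \<le> i" "i \<le> j" "j \<le> n"
  shows "x (\<sigma> i) \<le> x (\<sigma> j)"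
  using assms by (auto simp: is_ranking_def mono_on_def)

lemma gap_ranking:
  assumes "is_ranking n x \<sigma>" "i \<in> {1..n - 1}"
  shows "gap n x i = x (\<sigma> (i + 1)) - x (\<sigma> i)"
proof -
  have "i \<in> {1..n}" "i + 1 \<in> {1..n}" using assms(2) by auto
  then show ?thesis using assms(1) by (simp only: gap_def order_stat_ranking)
qed

section \<open>The largest gaps and the gaps at the cuts\<close>

lemma rev_sort_append:
  fixes u v :: "'a :: linorder list"
  assumes "mset w = mset u + mset v" "\<And>s t. s \<in> set u \<Longrightarrow> t \<in> set v \<Longrightarrow> t \<le> s"
  shows "rev (sort w) = rev (sort u) @ rev (sort v)"
proof -
  have "sort w = sort v @ sort u"
    by (rule properties_for_sort) (use assms in \<open>auto simp: sorted_append\<close>)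
  then show ?thesis by simp
qed

text \<open>The gaps at the cuts dominate all other gaps, so the decreasing list of all gaps begins
  with the decreasing list of the cut gaps. The witness \<open>gs\<close> lists the cut gaps by
  position; however ties are broken, its sorted version is the same.\<close>

lemma largest_gap_cuts:
  assumes "lg_indices n x Q \<iota>" "2 \<le> Q" "Q \<le> n"
  obtains gs where "length gs = Q - 1" "set gs = (\<lambda>k. gap n x (\<iota> k)) ` {1..Q - 1}"
    and "sum_list gs = (\<Sum>k = 1..Q - 1. gap n x (\<iota> k))"
    and "\<And>q. q \<in> {1..Q - 1} \<Longrightarrow> largest_gap n x q = rev (sort gs) ! (q - 1)"
proof
  let ?J = "\<iota> ` {1..Q - 1}"
  have J: "?J \<subseteq> {1..n - 1}" and sm: "strict_mono_on {1..Q - 1} \<iota>"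
    and top: "\<And>k i. k \<in> {1..Q - 1} \<Longrightarrow> i \<in> {1..n - 1} - ?J \<Longrightarrow> gap n x i \<le> gap n x (\<iota> k)"
    using assms(1) by (auto simp: lg_indices_def)
  have inj: "inj_on \<iota> {1..Q - 1}" using sm by (rule strict_mono_on_imp_inj_on)
  have J': "?J \<subseteq> {1..<n}"
  proof
    fix i assume "i \<in> ?J"
    then have "i \<in> {1..n - 1}" using J by blast
    then show "i \<in> {1..<n}" using assms by auto
  qed
  define us where "us = filter (\<lambda>i. i \<in> ?J) [1..<n]"
  define vs where "vs = filter (\<lambda>i. i \<notin> ?J) [1..<n]"
  let ?gs = "map (gap n x) us"
  have us: "distinct us" "set us = ?J" using J' by (auto simp: us_def)
  have len: "length us = Q - 1"
    using us inj by (metis card_atLeastAtMost card_image diff_Suc_1 distinct_card)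
  then show "length ?gs = Q - 1" by simp
  show "set ?gs = (\<lambda>k. gap n x (\<iota> k)) ` {1..Q - 1}" using us by (simp add: image_image)
  show "sum_list ?gs = (\<Sum>k = 1..Q - 1. gap n x (\<iota> k))"
    using us inj by (simp add: sum_list_distinct_conv_sum_set sum.reindex)
  have "rev (sort (map (gap n x) [1..<n])) = rev (sort ?gs) @ rev (sort (map (gap n x) vs))"
  proof (rule rev_sort_append)
    have "mset [1..<n] = mset us + mset vs" 
      unfolding us_def vs_def mset_filter by (rule multiset_partition)
    then show "mset (map (gap n x) [1..<n]) = mset ?gs + mset (map (gap n x) vs)"
      by (simp only: mset_map image_mset_union)
  next
    fix s t assume s: "s \<in> set ?gs" and t: "t \<in> set (map (gap n x) vs)"
    obtain k where "k \<in> {1..Q - 1}" "s = gap n x (\<iota> k)" using s us by auto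
    moreover obtain i where "i \<in> set vs" "t = gap n x i" using t by auto
    moreover have "set vs \<subseteq> {1..n - 1} - ?J" by (auto simp: vs_def)
    ultimately show "t \<le> s" using top by auto
  qed
  then show "largest_gap n x q = rev (sort ?gs) ! (q - 1)" if "q \<in> {1..Q - 1}" for q
    using that len by (auto simp: largest_gap_def nth_append)
qed

text \<open>Summation forgets the order, so the ordered gaps in the criterion may be replaced by the
  gaps at the cuts from left to right.\<close>

lemma sum_largest_gap:
  assumes "lg_indices n x Q \<iota>" "2 \<le> Q" "Q \<le> n"
  shows "(\<Sum>q = 1..Q - 1. largest_gap n x q) = (\<Sum>k = 1..Q - 1. gap n x (\<iota> k))"
proof -
  obtain gs where gs: "length gs = Q - 1"
    "sum_list gs = (\<Sum>k = 1..Q - 1. gap n x (\<iota> k))"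
    "\<And>q. q \<in> {1..Q - 1} \<Longrightarrow> largest_gap n x q = rev (sort gs) ! (q - 1)"
    using largest_gap_cuts[OF assms] by metis
  have "(\<Sum>q = 1..Q - 1. largest_gap n x q) = (\<Sum>q = 1..Q - 1. rev (sort gs) ! (q - 1))"
    using gs(3) by (intro sum.cong) auto
  also have "\<dots> = (\<Sum>i = 0..<Q - 1. rev (sort gs) ! i)"
    by (rule sum.reindex_bij_witness[of _ Suc "\<lambda>q. q - 1"]) auto
  also have "\<dots> = sum_list (rev (sort gs))" using gs(1) by (simp add: sum_list_sum_nth)
  also have "\<dots> = sum_list gs" by (metis mset_rev mset_sort sum_mset_sum_list)
  finally show ?thesis using gs(2) by simp
qed

lemma largest_gap_last:
  assumes "lg_indices n x Q \<iota>" "2 \<le> Q" "Q \<le> n"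
  shows "\<exists>k\<in>{1..Q - 1}. largest_gap n x (Q - 1) = gap n x (\<iota> k)"
    and "k \<in> {1..Q - 1} \<Longrightarrow> largest_gap n x (Q - 1) \<le> gap n x (\<iota> k)"
proof -
  obtain gs where gs: "length gs = Q - 1" "set gs = (\<lambda>k. gap n x (\<iota> k)) ` {1..Q - 1}"
    "\<And>q. q \<in> {1..Q - 1} \<Longrightarrow> largest_gap n x q = rev (sort gs) ! (q - 1)"
    using largest_gap_cuts[OF assms] by metis
  \<comment> \<open>The last entry of the decreasing list is the head of the increasing one, hence
    the smallest cut gap.\<close>
  have last: "largest_gap n x (Q - 1) = sort gs ! 0"
    using gs(1) gs(3)[of "Q - 1"] assms by (simp add: rev_nth)
  moreover have "sort gs ! 0 \<in> set gs"
    using gs(1) assms(2) nth_mem[of 0 "sort gs"] by simp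
  ultimately show "\<exists>k\<in>{1..Q - 1}. largest_gap n x (Q - 1) = gap n x (\<iota> k)"
    using gs(2) by auto
  assume "k \<in> {1..Q - 1}"
  then have "gap n x (\<iota> k) \<in> set (sort gs)" using gs(2) by auto
  then obtain j where "j < length (sort gs)" "sort gs ! j = gap n x (\<iota> k)"
    unfolding in_set_conv_nth by blast
  then show "largest_gap n x (Q - 1) \<le> gap n x (\<iota> k)"
    using last sorted_nth_mono[OF sorted_sort, of 0 j gs] by simp
qed

section \<open>Blocks of positions between consecutive cuts\<close>

text \<open>Monotonicity is given only for the interior cuts; the conventions
  \<open>\<iota> 0 = 0\<close> and \<open>\<iota> Q = n\<close> extend it to both ends because
  interior cuts lie strictly between 0 and \<open>n\<close>.\<close>

lemma cuts_strict_mono: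
  assumes "lg_indices n x Q \<iota>" "2 \<le> Q" "k < l" "l \<le> Q"
  shows "\<iota> k < \<iota> l"
proof -
  have \<iota>: "\<iota> 0 = 0" "\<iota> Q = n" "\<And>k. k \<in> {1..Q - 1} \<Longrightarrow> \<iota> k \<in> {1..n - 1}"
    "strict_mono_on {1..Q - 1} \<iota>"
    using assms(1) unfolding lg_indices_def by blast+
  have mid: "0 < \<iota> k \<and> \<iota> k < n" if "1 \<le> k" "k < Q" for k
    using \<iota>(3)[of k] that by simp linarith
  have "0 < n" using mid[of 1] assms(2) by simp
  then consider "k = 0" "l = Q" | "k = 0" "1 \<le> l" "l < Q" | "1 \<le> k" "k < Q" "l = Q"
    | "k \<in> {1..Q - 1}" "l \<in> {1..Q - 1}"
    using assms(2-4) by fastforce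
  then show ?thesis
    using mid \<iota>(1,2) \<open>0 < n\<close> strict_mono_onD[OF \<iota>(4) _ _ assms(3)] by cases auto
qed

lemma cuts_bounds:
  assumes "lg_indices n x Q \<iota>" "2 \<le> Q" "l \<in> {1..Q}"
  shows "\<iota> (l - 1) < \<iota> l" "\<iota> l \<le> n"
proof -
  show "\<iota> (l - 1) < \<iota> l" using cuts_strict_mono[OF assms(1,2)] assms(3) by auto
  have "\<iota> Q = n" using assms(1) by (simp add: lg_indices_def)
  then show "\<iota> l \<le> n"
    using cuts_strict_mono[OF assms(1,2), of l Q] assms(3) by (cases "l = Q") auto
qed

lemma cuts_cover:
  assumes "lg_indices n x Q \<iota>" "j \<in> {1..n}"
  obtains l where "l \<in> {1..Q}" "j \<in> {\<iota> (l - 1)<..\<iota> l}"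
proof -
  have \<iota>: "\<iota> 0 = 0" "\<iota> Q = n" using assms(1) by (auto simp: lg_indices_def)
  \<comment> \<open>Minimality gives the strict lower bound of the block, and
    \<open>\<iota> 0 = 0\<close> excludes the index 0.\<close>
  define l where "l = (LEAST l. j \<le> \<iota> l)"
  have "j \<le> \<iota> l" unfolding l_def by (rule LeastI[of "\<lambda>l. j \<le> \<iota> l" Q]) (use \<iota>(2) assms(2) in simp)
  moreover have "l \<le> Q" unfolding l_def by (rule Least_le) (use \<iota>(2) assms(2) in simp)
  moreover have "l \<noteq> 0"
  proof
    assume "l = 0"
    then show False using \<open>j \<le> \<iota> l\<close> \<iota>(1) assms(2) by simp
  qed
  moreover have "\<not> j \<le> \<iota> (l - 1)"
  proof
    assume "j \<le> \<iota> (l - 1)"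
    then have "l \<le> l - 1" unfolding l_def by (rule Least_le)
    then show False using \<open>l \<noteq> 0\<close> by simp
  qed
  ultimately show ?thesis using that[of l] by simp
qed

text \<open>Two positions in different blocks have a whole cut gap, from \<open>\<iota> k\<close> to
  \<open>\<iota> k + 1\<close>, between them. This is how a large cut gap will force their degrees
  apart.\<close>

lemma cuts_separate:
  assumes "lg_indices n x Q \<iota>" "2 \<le> Q" "k \<in> {1..Q}" "l \<in> {1..Q}"
    and "i \<in> {\<iota> (k - 1)<..\<iota> k}" "j \<in> {\<iota> (l - 1)<..\<iota> l}" "k < l"
  shows "i \<le> \<iota> k" "\<iota> k + 1 \<le> j" "k \<in> {1..Q - 1}"
proof -
  have "\<iota> k \<le> \<iota> (l - 1)"
  proof (cases "k = l - 1")
    case False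
    then have "k < l - 1" "l - 1 \<le> Q" using assms(4,7) by auto
    then show ?thesis using cuts_strict_mono[OF assms(1,2)] by (simp add: less_imp_le)
  qed simp
  then show "i \<le> \<iota> k" "\<iota> k + 1 \<le> j" "k \<in> {1..Q - 1}" using assms by auto
qed

section \<open>Means pulled away from the extremes by a subset\<close>

text \<open>The differences \<open>x i - lo\<close> are nonnegative on \<open>C\<close>, so their
  sum is at least the part coming from \<open>B\<close>. With \<open>B\<close> empty this is the
  plain lower bound of a mean; with \<open>B\<close> a fixed proportion of \<open>C\<close> it keeps
  the mean away from the minimum.\<close>

lemma mean_ge:
  fixes x :: "'b \<Rightarrow> real"
  assumes "finite C" "C \<noteq> {}" "B \<subseteq> C"
    and "\<And>i. i \<in> C \<Longrightarrow> lo \<le> x i" "\<And>i. i \<in> B \<Longrightarrow> lo + d \<le> x i"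
  shows "lo + real (card B) / real (card C) * d \<le> (\<Sum>i\<in>C. x i) / real (card C)"
proof -
  have pos: "real (card C) > 0" using assms(1,2) by (simp add: card_gt_0_iff)
  have "real (card B) * d = (\<Sum>i\<in>B. d)" by simp
  also have "\<dots> \<le> (\<Sum>i\<in>B. x i - lo)" using assms(5) by (intro sum_mono) (simp add: algebra_simps)
  also have "\<dots> \<le> (\<Sum>i\<in>C. x i - lo)" using assms by (intro sum_mono2) auto
  also have "\<dots> = (\<Sum>i\<in>C. x i) - real (card C) * lo" by (simp add: sum_subtractf)
  finally have "(lo * real (card C) + real (card B) * d) / real (card C)
      \<le> (\<Sum>i\<in>C. x i) / real (card C)"
    by (intro divide_right_mono) (auto simp: algebra_simps)
  then show ?thesis using pos by (simp add: add_divide_distrib)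
qed

lemma mean_le:
  fixes x :: "'b \<Rightarrow> real"
  assumes "finite C" "C \<noteq> {}" "B \<subseteq> C"
    and "\<And>i. i \<in> C \<Longrightarrow> x i \<le> hi" "\<And>i. i \<in> B \<Longrightarrow> x i \<le> hi - d"
  shows "(\<Sum>i\<in>C. x i) / real (card C) \<le> hi - real (card B) / real (card C) * d"
proof -
  have "- hi + real (card B) / real (card C) * d \<le> (\<Sum>i\<in>C. - x i) / real (card C)"
    by (rule mean_ge[OF assms(1-3)]) (use assms(4,5) in force)+
  then show ?thesis by (simp add: sum_negf)
qed

section \<open>A single run of the algorithm\<close>

text \<open>The choices \<open>\<sigma>\<close> and \<open>\<iota>\<close> that break the ties are
  fixed but arbitrary, so every consequence holds for every possible output.\<close>

locale lg_run =
  fixes n :: nat and x :: "nat \<Rightarrow> real" and Q :: nat and C :: "nat \<Rightarrow> nat set"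
    and \<sigma> \<iota> :: "nat \<Rightarrow> nat"
  assumes rank: "is_ranking n x \<sigma>" and cuts: "lg_indices n x Q \<iota>"
    and Q: "2 \<le> Q" "Q \<le> n"
    and C: "\<And>k. k \<in> {1..Q} \<Longrightarrow> C k = \<sigma> ` {\<iota> (k - 1)<..\<iota> k}"
begin

abbreviation "m \<equiv> class_mean x C"

lemma \<sigma>_bij: "bij_betw \<sigma> {1..n} {1..n}"
  using rank by (simp add: is_ranking_def)

lemma \<sigma>_in: "i \<in> {1..n} \<Longrightarrow> \<sigma> i \<in> {1..n}"
  using \<sigma>_bij by (auto simp: bij_betw_def)

lemma \<sigma>_surj: "i \<in> {1..n} \<Longrightarrow> \<exists>j\<in>{1..n}. \<sigma> j = i"
  using \<sigma>_bij by (metis bij_betw_def imageE)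

lemma cut_in: "k \<in> {1..Q - 1} \<Longrightarrow> \<iota> k \<in> {1..n - 1}"
  using cuts unfolding lg_indices_def by blast

lemma class_props:
  assumes "l \<in> {1..Q}"
  shows "finite (C l)" "C l \<noteq> {}" "C l \<subseteq> {1..n}"
proof -
  show "finite (C l)" "C l \<noteq> {}" using C[OF assms] cuts_bounds[OF cuts Q(1) assms] by auto
  show "C l \<subseteq> {1..n}" using C[OF assms] cuts_bounds(2)[OF cuts Q(1) assms] \<sigma>_in by fastforce
qed

lemma class_bounds:
  assumes "l \<in> {1..Q}" "i \<in> C l"
  shows "x (\<sigma> (\<iota> (l - 1) + 1)) \<le> x i" "x i \<le> x (\<sigma> (\<iota> l))"
proof -
  obtain j where j: "i = \<sigma> j" "\<iota> (l - 1) < j" "j \<le> \<iota> l" using C assms by auto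
  have "\<iota> l \<le> n" using cuts_bounds(2)[OF cuts Q(1) assms(1)] .
  then show "x (\<sigma> (\<iota> (l - 1) + 1)) \<le> x i" "x i \<le> x (\<sigma> (\<iota> l))"
    using j by (auto intro!: ranking_mono[OF rank])
qed

lemma class_extremes:
  assumes "l \<in> {1..Q}"
  shows "\<sigma> (\<iota> (l - 1) + 1) \<in> C l" "\<sigma> (\<iota> l) \<in> C l"
  using C[OF assms] cuts_bounds[OF cuts Q(1) assms] by auto

lemma class_mean_bounds:
  assumes "l \<in> {1..Q}"
  shows "x (\<sigma> (\<iota> (l - 1) + 1)) \<le> m l" "m l \<le> x (\<sigma> (\<iota> l))"
proof -
  \<comment> \<open>The empty set serves as \<open>B\<close>, so the refined bounds reduce to
    minimum and maximum.\<close>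
  note Cl = class_props(1,2)[OF assms] empty_subsetI
  show "x (\<sigma> (\<iota> (l - 1) + 1)) \<le> m l"
    using mean_ge[OF Cl class_bounds(1)[OF assms], where d = 0] by (simp add: class_mean_def)
  show "m l \<le> x (\<sigma> (\<iota> l))"
    using mean_le[OF Cl class_bounds(2)[OF assms], where d = 0] by (simp add: class_mean_def)
qed

definition excess :: real where
  "excess = (\<Sum>q = 1..Q - 1. largest_gap Q m q - largest_gap n x q)"

text \<open>The estimated classes are ordered, so the gaps between their means telescope and the
  ordered sums in the criterion can be taken in the order of the classes.\<close>

lemma excess_eq:
  "excess = (\<Sum>k = 1..Q - 1. (m (k + 1) - x (\<sigma> (\<iota> k + 1))) + (x (\<sigma> (\<iota> k)) - m k))"
proof -
  have step_mono: "m k \<le> m (k + 1)" if "k \<in> {1..Q - 1}" for k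
  proof -
    have "m k \<le> x (\<sigma> (\<iota> k))" using class_mean_bounds(2)[of k] that by auto
    also have "\<dots> \<le> x (\<sigma> (\<iota> k + 1))" using cut_in[OF that] by (intro ranking_mono[OF rank]) auto
    also have "\<dots> \<le> m (k + 1)" using class_mean_bounds(1)[of "k + 1"] that by auto
    finally show ?thesis .
  qed
  have "m k \<le> m l" if "1 \<le> k" "k \<le> l" "l \<le> Q" for k l
    using that(2,3)
  proof (induction l rule: dec_induct)
    case (step j)
    then show ?case using \<open>1 \<le> k\<close> step_mono[of j] by fastforce
  qed simp
  then have id: "is_ranking Q m (\<lambda>q. q)"
    by (auto simp: is_ranking_def mono_on_def bij_betw_def)
  \<comment> \<open>All \<open>Q - 1\<close> gaps between the means are cuts, so no index is left to
    be dominated.\<close>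
  have "lg_indices Q m Q (\<lambda>q. q)"
    by (auto simp: lg_indices_def strict_mono_on_def)
  then have "(\<Sum>q = 1..Q - 1. largest_gap Q m q) = (\<Sum>k = 1..Q - 1. gap Q m k)"
    using sum_largest_gap Q by blast
  also have "\<dots> = (\<Sum>k = 1..Q - 1. m (k + 1) - m k)"
    by (intro sum.cong refl gap_ranking[OF id])
  finally have "excess = (\<Sum>k = 1..Q - 1. (m (k + 1) - m k) - gap n x (\<iota> k))"
    unfolding excess_def sum_subtractf sum_largest_gap[OF cuts Q] by simp
  also have "\<dots> = (\<Sum>k = 1..Q - 1. (m (k + 1) - x (\<sigma> (\<iota> k + 1))) + (x (\<sigma> (\<iota> k)) - m k))"
    using gap_ranking[OF rank cut_in] by (intro sum.cong refl) simp
  finally show ?thesis .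
qed

lemma excess_terms_nonneg:
  assumes "k \<in> {1..Q - 1}"
  shows "0 \<le> m (k + 1) - x (\<sigma> (\<iota> k + 1))" "0 \<le> x (\<sigma> (\<iota> k)) - m k"
  using class_mean_bounds(1)[of "k + 1"] class_mean_bounds(2)[of k] assms by auto

lemma excess_nonneg: "0 \<le> excess"
  unfolding excess_eq using excess_terms_nonneg by (intro sum_nonneg add_nonneg_nonneg) auto

text \<open>A single nonnegative term of the sum already suffices. The first class enters the sum
  only through the distance of its mean to its maximum and the last only through the distance to its
  minimum, so both distances are assumed to be at least \<open>c\<close>.\<close>

lemma excess_ge:
  assumes "l \<in> {1..Q}" "c \<le> m l - x (\<sigma> (\<iota> (l - 1) + 1))" "c \<le> x (\<sigma> (\<iota> l)) - m l"
  shows "c \<le> excess"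
proof -
  \<comment> \<open>No cut lies to the right of the last class; its lower distance appears in the
    term \<open>Q - 1\<close>. Every other class is seen through its upper distance.\<close>
  define k where "k = (if l = Q then Q - 1 else l)"
  have k: "k \<in> {1..Q - 1}" using assms(1) Q by (auto simp: k_def)
  have "c \<le> (m (k + 1) - x (\<sigma> (\<iota> k + 1))) + (x (\<sigma> (\<iota> k)) - m k)"
    using excess_terms_nonneg[OF k] assms Q by (cases "l = Q") (auto simp: k_def)
  also have "\<dots> \<le> excess"
    unfolding excess_eq using k excess_terms_nonneg
    by (intro member_le_sum add_nonneg_nonneg) auto
  finally show ?thesis .
qed

text \<open>Each of the \<open>Q - 1\<close> terms is made of two distances from a class mean to an
  extreme of the same class, and neither exceeds the spread of that class.\<close>

lemma excess_le:
  assumes "\<And>l i j. l \<in> {1..Q} \<Longrightarrow> i \<in> C l \<Longrightarrow> j \<in> C l \<Longrightarrow> x i - x j \<le> d"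
  shows "excess \<le> real (Q - 1) * (2 * d)"
proof -
  have spread: "m l - x (\<sigma> (\<iota> (l - 1) + 1)) \<le> d" "x (\<sigma> (\<iota> l)) - m l \<le> d" if "l \<in> {1..Q}" for l
    using class_mean_bounds[OF that] assms[OF that class_extremes(2)[OF that] class_extremes(1)[OF that]]
    by auto
  have "excess \<le> (\<Sum>k = 1..Q - 1. 2 * d)"
    unfolding excess_eq
  proof (rule sum_mono)
    fix k assume "k \<in> {1..Q - 1}"
    then have "k \<in> {1..Q}" "k + 1 \<in> {1..Q}" by auto
    then show "(m (k + 1) - x (\<sigma> (\<iota> k + 1))) + (x (\<sigma> (\<iota> k)) - m k) \<le> 2 * d"
      using spread(1)[of "k + 1"] spread(2)[of k] by simp
  qed
  then show ?thesis by simp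
qed

lemma last_gap_nonneg: "0 \<le> largest_gap n x (Q - 1)"
proof -
  obtain k where k: "k \<in> {1..Q - 1}" "largest_gap n x (Q - 1) = gap n x (\<iota> k)"
    using largest_gap_last(1)[OF cuts Q] by blast
  moreover have "x (\<sigma> (\<iota> k)) \<le> x (\<sigma> (\<iota> k + 1))"
    using cut_in[OF k(1)] by (intro ranking_mono[OF rank]) auto
  ultimately show ?thesis using gap_ranking[OF rank cut_in[OF k(1)]] by simp
qed

lemma criterion_eq:
  "lg_criterion \<beta> n x Q C =
     ereal excess + 1 / ereal (real n powr ((1 - \<beta>) / 2) * largest_gap n x (Q - 1))"
  by (simp add: lg_criterion_def excess_def)

lemma criterion_ge:
  assumes "e \<le> excess"
  shows "ereal e \<le> lg_criterion \<beta> n x Q C"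
proof -
  have "0 \<le> 1 / ereal (real n powr ((1 - \<beta>) / 2) * largest_gap n x (Q - 1))"
    using last_gap_nonneg by simp
  then show ?thesis
    unfolding criterion_eq using assms by (metis add.right_neutral add_mono ereal_less_eq(3))
qed

lemma criterion_ge_inverse:
  assumes "largest_gap n x (Q - 1) \<le> g" "0 < g"
  shows "ereal (1 / (real n powr ((1 - \<beta>) / 2) * g)) \<le> lg_criterion \<beta> n x Q C"
proof -
  let ?r = "real n powr ((1 - \<beta>) / 2)" and ?G = "largest_gap n x (Q - 1)"
  have r: "0 < ?r" using Q by simp
  have "ereal (1 / (?r * g)) \<le> 1 / ereal (?r * ?G)"
  \<comment> \<open>For a vanishing gap the penalty is \<infinity> and the bound is trivial.\<close>
  proof (cases "?G = 0")
    case False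
    then have "0 < ?G" using last_gap_nonneg by simp
    then have "1 / (?r * g) \<le> 1 / (?r * ?G)"
      using assms r by (intro divide_left_mono mult_left_mono mult_pos_pos) auto
    then show ?thesis using \<open>0 < ?G\<close> r by (simp add: one_ereal_def)
  qed (simp add: one_ereal_def)
  then show ?thesis
    unfolding criterion_eq using excess_nonneg
    by (metis add_0 add_mono ereal_less_eq(5))
qed

lemma criterion_le:
  assumes "excess \<le> e" "g \<le> largest_gap n x (Q - 1)" "0 < g"
  shows "lg_criterion \<beta> n x Q C \<le> ereal (e + 1 / (real n powr ((1 - \<beta>) / 2) * g))"
proof -
  let ?r = "real n powr ((1 - \<beta>) / 2)" and ?G = "largest_gap n x (Q - 1)"
  have r: "0 < ?r" using Q by simp
  have "1 / (?r * ?G) \<le> 1 / (?r * g)"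
    using assms r by (intro divide_left_mono mult_left_mono mult_pos_pos) auto
  then show ?thesis
    unfolding criterion_eq using assms r by (simp add: one_ereal_def)
qed

end

section \<open>The algorithm on concentrated degrees\<close>

text \<open>The deterministic content of the event that degrees and label counts concentrate:
  \<open>p\<close> gives the mean degree of each label, \<open>\<delta>\<close> the separation of
  these means, \<open>s\<close> the error of the degrees and \<open>a\<close> a lower bound on the
  class proportions. The condition \<open>4 * s < \<delta>\<close> makes
  \<open>\<delta> - 2 * s\<close> exceed \<open>2 * s\<close>, so gaps within a label and gaps
  between labels cannot be confused.\<close>

locale lg_run_concentrated = lg_run +
  fixes Q0 :: nat and z :: "nat \<Rightarrow> nat" and p :: "nat \<Rightarrow> real" and \<delta> s a :: real
  assumes label: "\<And>i. i \<in> {1..n} \<Longrightarrow> z i \<in> {1..Q0}"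
    and sep: "\<And>q r. q \<in> {1..Q0} \<Longrightarrow> r \<in> {1..Q0} \<Longrightarrow> q \<noteq> r \<Longrightarrow> \<delta> \<le> \<bar>p q - p r\<bar>"
    and close: "\<And>i. i \<in> {1..n} \<Longrightarrow> \<bar>x i - p (z i)\<bar> \<le> s"
    and small: "0 < s" "4 * s < \<delta>"
    and freq: "0 < a" "\<And>q. q \<in> {1..Q0} \<Longrightarrow> a * real n \<le> real (card {i \<in> {1..n}. z i = q})"
begin

lemma same_label_close:
  assumes "i \<in> {1..n}" "j \<in> {1..n}" "z i = z j"
  shows "x i - x j \<le> 2 * s"
  using close[OF assms(1)] close[OF assms(2)] assms(3) by simp

lemma label_ex:
  assumes "q \<in> {1..Q0}"
  shows "\<exists>i\<in>{1..n}. z i = q"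
proof -
  have "0 < a * real n" using freq(1) Q by simp
  then have "card {i \<in> {1..n}. z i = q} \<noteq> 0" using freq(2)[OF assms] by linarith
  then have "{i \<in> {1..n}. z i = q} \<noteq> {}" using card.empty by metis
  then show ?thesis by blast
qed

text \<open>Nodes on the two sides of a gap above \<open>2 * s\<close> carry different labels.
  Sending each such gap to the label at its left end is therefore injective.\<close>

lemma card_large_gaps_le: "card {i \<in> {1..n - 1}. 2 * s < gap n x i} + 1 \<le> Q0"
proof -
  let ?J = "{i \<in> {1..n - 1}. 2 * s < gap n x i}"
  \<comment> \<open>The last position is added because \<open>k\<close> gaps delimit
    \<open>k + 1\<close> groups; it produces the \<open>+ 1\<close> of the statement.\<close>
  have diff: "z (\<sigma> i) \<noteq> z (\<sigma> j)" if "i \<in> insert n ?J" "j \<in> insert n ?J" "i < j" for i j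
  proof
    assume eq: "z (\<sigma> i) = z (\<sigma> j)"
    have ij: "1 \<le> i" "j \<le> n" "i \<in> ?J" using that by auto
    have "2 * s < x (\<sigma> (i + 1)) - x (\<sigma> i)" using ij(3) gap_ranking[OF rank, of i] by simp
    also have "x (\<sigma> (i + 1)) \<le> x (\<sigma> j)" using ij that by (intro ranking_mono[OF rank]) auto
    finally have "2 * s < x (\<sigma> j) - x (\<sigma> i)" by simp
    then show False
      using same_label_close[of "\<sigma> j" "\<sigma> i"] eq \<sigma>_in[of i] \<sigma>_in[of j] ij that(3) by simp
  qed
  have "inj_on (\<lambda>i. z (\<sigma> i)) (insert n ?J)"
  proof (rule inj_onI)
    fix i j assume "i \<in> insert n ?J" "j \<in> insert n ?J" "z (\<sigma> i) = z (\<sigma> j)"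
    then show "i = j" using diff[of i j] diff[of j i] by (cases i j rule: linorder_cases) auto
  qed
  moreover have "(\<lambda>i. z (\<sigma> i)) ` insert n ?J \<subseteq> {1..Q0}"
    using label \<sigma>_in Q by auto
  ultimately have "card (insert n ?J) \<le> card {1..Q0}"
    by (metis card_image card_mono finite_atLeastAtMost)
  then show ?thesis using Q by (subst (asm) card_insert_disjoint) auto
qed

text \<open>Just after the last occurrence of a label comes a node with another label, hence a large
  gap. At most one label has its last occurrence at position \<open>n\<close>, where no gap
  follows.\<close>

lemma card_large_gaps_ge: "Q0 \<le> card {i \<in> {1..n - 1}. \<delta> - 2 * s \<le> gap n x i} + 1"
proof -
  let ?K = "{i \<in> {1..n - 1}. \<delta> - 2 * s \<le> gap n x i}"
  define g where "g q = Max {i \<in> {1..n}. z (\<sigma> i) = q}" for q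
  have g: "g q \<in> {1..n}" "z (\<sigma> (g q)) = q" and g_max: "\<And>i. i \<in> {1..n} \<Longrightarrow> z (\<sigma> i) = q \<Longrightarrow> i \<le> g q"
    if "q \<in> {1..Q0}" for q
  proof -
    obtain i where "i \<in> {1..n}" "z i = q" using label_ex[OF \<open>q \<in> {1..Q0}\<close>] by blast
    then obtain j where "j \<in> {1..n}" "z (\<sigma> j) = q" using \<sigma>_surj by blast
    then have "{i \<in> {1..n}. z (\<sigma> i) = q} \<noteq> {}" by blast
    then have "g q \<in> {i \<in> {1..n}. z (\<sigma> i) = q}" unfolding g_def by (intro Max_in) auto
    then show "g q \<in> {1..n}" "z (\<sigma> (g q)) = q" by auto
    show "\<And>i. i \<in> {1..n} \<Longrightarrow> z (\<sigma> i) = q \<Longrightarrow> i \<le> g q" unfolding g_def by (intro Max_ge) auto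
  qed
  have "g ` {1..Q0} - {n} \<subseteq> ?K"
  proof
    fix i assume "i \<in> g ` {1..Q0} - {n}"
    then obtain q where q: "q \<in> {1..Q0}" "i = g q" "i \<noteq> n" by blast
    have i: "i \<in> {1..n}" "i + 1 \<in> {1..n}" "i \<in> {1..n - 1}" using g(1)[OF q(1)] q by auto
    let ?r = "z (\<sigma> (i + 1))"
    have r: "?r \<in> {1..Q0}" using label \<sigma>_in i by blast
    have "?r \<noteq> q" using g_max[OF q(1) i(2)] q(2) by auto
    then have "\<delta> \<le> \<bar>p ?r - p q\<bar>" using sep[OF r q(1)] by simp
    moreover have "\<bar>x (\<sigma> i) - p q\<bar> \<le> s" "\<bar>x (\<sigma> (i + 1)) - p ?r\<bar> \<le> s"
      using close[OF \<sigma>_in[OF i(1)]] close[OF \<sigma>_in[OF i(2)]] g(2)[OF q(1)] q(2) by auto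
    moreover have "x (\<sigma> i) \<le> x (\<sigma> (i + 1))" using i by (intro ranking_mono[OF rank]) auto
    \<comment> \<open>Separation alone bounds only the absolute difference; the sorting of the
      degrees fixes its sign.\<close>
    ultimately have "\<delta> - 2 * s \<le> x (\<sigma> (i + 1)) - x (\<sigma> i)" using small by linarith
    then show "i \<in> ?K" using i(3) gap_ranking[OF rank i(3)] by simp
  qed
  then have "card (g ` {1..Q0} - {n}) \<le> card ?K" by (intro card_mono) auto
  moreover have "inj_on g {1..Q0}" using g(2) by (metis inj_onI)
  then have "card (g ` {1..Q0}) = Q0" by (simp add: card_image)
  moreover have "card (g ` {1..Q0}) \<le> card (g ` {1..Q0} - {n}) + 1"
    using diff_card_le_card_Diff[of "{n}" "g ` {1..Q0}"] by simp
  ultimately show ?thesis by simp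
qed

lemma card_cuts: "card (\<iota> ` {1..Q - 1}) = Q - 1"
proof -
  have "strict_mono_on {1..Q - 1} \<iota>" using cuts unfolding lg_indices_def by blast
  then show ?thesis by (simp add: card_image strict_mono_on_imp_inj_on)
qed

text \<open>Counting: if one cut gap were smaller, every large gap would have to be among the other
  \<open>Q - 2\<close> cuts, but at least \<open>Q0 - 1\<close> large gaps exist.\<close>

lemma gap_cut_ge:
  assumes "Q \<le> Q0" "k \<in> {1..Q - 1}"
  shows "\<delta> - 2 * s \<le> gap n x (\<iota> k)"
proof (rule ccontr)
  assume neg: "\<not> \<delta> - 2 * s \<le> gap n x (\<iota> k)"
  let ?K = "{i \<in> {1..n - 1}. \<delta> - 2 * s \<le> gap n x i}"
  have "?K \<subseteq> \<iota> ` {1..Q - 1} - {\<iota> k}"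
  proof
    fix i assume i: "i \<in> ?K"
    have "i \<in> \<iota> ` {1..Q - 1}"
    proof (rule ccontr)
      assume "i \<notin> \<iota> ` {1..Q - 1}"
      then have "gap n x i \<le> gap n x (\<iota> k)"
        using cuts assms(2) i unfolding lg_indices_def by blast
      then show False using neg i by simp
    qed
    moreover have "i \<noteq> \<iota> k" using neg i by blast
    ultimately show "i \<in> \<iota> ` {1..Q - 1} - {\<iota> k}" by blast
  qed
  then have "card ?K \<le> card (\<iota> ` {1..Q - 1} - {\<iota> k})" by (intro card_mono) auto
  also have "\<dots> = Q - 2" using card_cuts assms(2) by (subst card_Diff_singleton) auto
  finally show False using card_large_gaps_ge assms Q by linarith
qed

lemma last_gap_ge: "Q \<le> Q0 \<Longrightarrow> \<delta> - 2 * s \<le> largest_gap n x (Q - 1)"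
  using largest_gap_last(1)[OF cuts Q] gap_cut_ge by metis

text \<open>The reverse count: \<open>Q - 1\<close> cuts are too many for the at most
  \<open>Q0 - 1\<close> gaps above \<open>2 * s\<close>.\<close>

lemma last_gap_le:
  assumes "Q0 < Q"
  shows "largest_gap n x (Q - 1) \<le> 2 * s"
proof (rule ccontr)
  assume "\<not> ?thesis"
  then have "\<iota> ` {1..Q - 1} \<subseteq> {i \<in> {1..n - 1}. 2 * s < gap n x i}"
    using largest_gap_last(2)[OF cuts Q] cut_in by fastforce
  then have "card (\<iota> ` {1..Q - 1}) \<le> card {i \<in> {1..n - 1}. 2 * s < gap n x i}"
    by (intro card_mono) auto
  then show False using card_cuts card_large_gaps_le assms by linarith
qed

section \<open>Estimated classes as unions of true classes\<close>

lemma node_class: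
  assumes "i \<in> {1..n}"
  shows "\<exists>l\<in>{1..Q}. i \<in> C l"
proof -
  obtain j where j: "j \<in> {1..n}" "i = \<sigma> j" using \<sigma>_surj[OF assms] by blast
  obtain l where "l \<in> {1..Q}" "j \<in> {\<iota> (l - 1)<..\<iota> l}" using cuts_cover[OF cuts j(1)] .
  then show ?thesis using C j by blast
qed

text \<open>Two estimated classes are separated by a cut gap of at least
  \<open>\<delta> - 2 * s\<close>, which is more than the \<open>2 * s\<close> by which degrees with
  a common label can differ.\<close>

lemma same_label_class:
  assumes "Q \<le> Q0" "i \<in> C k" "j \<in> C l" "k \<in> {1..Q}" "l \<in> {1..Q}" "z i = z j"
  shows "k = l"
proof -
  have "\<not> k < l"
    if "i \<in> C k" "j \<in> C l" "k \<in> {1..Q}" "l \<in> {1..Q}" "z i = z j" for i j k l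
  proof
    assume less: "k < l"
    note C_kl = C[OF that(3)] C[OF that(4)]
    obtain u v where u: "u \<in> {\<iota> (k - 1)<..\<iota> k}" "i = \<sigma> u" and v: "v \<in> {\<iota> (l - 1)<..\<iota> l}" "j = \<sigma> v"
      using C_kl \<open>i \<in> C k\<close> \<open>j \<in> C l\<close> by blast
    note sep = cuts_separate[OF cuts Q(1) that(3,4) u(1) v(1) less]
    have uv: "1 \<le> u" "v \<le> n" using u v cuts_bounds(2)[OF cuts Q(1) that(4)] by auto
    have "x i \<le> x (\<sigma> (\<iota> k))" using u uv sep v by (auto intro!: ranking_mono[OF rank])
    moreover have "x (\<sigma> (\<iota> k + 1)) \<le> x j" using v uv sep by (auto intro!: ranking_mono[OF rank])
    moreover have "\<delta> - 2 * s \<le> x (\<sigma> (\<iota> k + 1)) - x (\<sigma> (\<iota> k))"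
      using gap_cut_ge[OF assms(1) sep(3)] gap_ranking[OF rank cut_in[OF sep(3)]] by simp
    moreover have "x j - x i \<le> 2 * s"
      using same_label_close[of j i] class_props(3) that by (metis subsetD)
    ultimately show False using small by linarith
  qed
  \<comment> \<open>The one-sided claim is applied in both orders of the two nodes.\<close>
  from this[OF assms(2-6)] this[OF assms(3,2,5,4) assms(6)[symmetric]] show ?thesis by simp
qed

text \<open>The map \<open>b\<close> sends a true label to the estimated class containing all its
  nodes. Merging and exact recovery thereby become questions of injectivity between finite sets of
  labels.\<close>

lemma label_class:
  assumes "Q \<le> Q0"
  shows "\<exists>b. (\<forall>q\<in>{1..Q0}. b q \<in> {1..Q}) \<and>
    (\<forall>l\<in>{1..Q}. \<forall>i\<in>{1..n}. i \<in> C l \<longleftrightarrow> b (z i) = l)"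
proof -
  have "\<exists>l\<in>{1..Q}. \<exists>i\<in>{1..n}. z i = q \<and> i \<in> C l" if "q \<in> {1..Q0}" for q
    using label_ex[OF that] node_class by blast
  then obtain b where b: "\<And>q. q \<in> {1..Q0} \<Longrightarrow> b q \<in> {1..Q} \<and> (\<exists>i\<in>{1..n}. z i = q \<and> i \<in> C (b q))"
    by metis
  show ?thesis
  proof (intro exI[of _ b] conjI ballI)
    show "b q \<in> {1..Q}" if "q \<in> {1..Q0}" for q using b[OF that] by blast
    fix l i assume l: "l \<in> {1..Q}" and i: "i \<in> {1..n}"
    obtain j where j: "j \<in> {1..n}" "z j = z i" "j \<in> C (b (z i))" and bi: "b (z i) \<in> {1..Q}"
      using b[OF label[OF i]] by blast
    obtain l' where l': "l' \<in> {1..Q}" "i \<in> C l'" using node_class[OF i] by blast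
    have "l' = b (z i)" using same_label_class[OF assms l'(2) j(3) l'(1) bi] j(2) by simp
    moreover have "l = l'" if "i \<in> C l" using same_label_class[OF assms that l'(2) l l'(1)] by simp
    ultimately show "i \<in> C l \<longleftrightarrow> b (z i) = l" using l'(2) by blast
  qed
qed

text \<open>By the pigeonhole principle some estimated class contains two labels with
  \<open>p q < p r\<close>. The nodes labelled \<open>r\<close> push its mean above the minimum,
  those labelled \<open>q\<close> pull it below the maximum, and each group is at least a proportion
  \<open>a\<close> of the class.\<close>

lemma excess_ge_merged:
  assumes "Q < Q0"
  shows "a * (\<delta> - 2 * s) \<le> excess"
proof -
  obtain b where "\<forall>q\<in>{1..Q0}. b q \<in> {1..Q}" "\<forall>l\<in>{1..Q}. \<forall>i\<in>{1..n}. i \<in> C l \<longleftrightarrow> b (z i) = l"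
    using label_class[OF less_imp_le[OF assms]] by blast
  note b = this[rule_format]
  have "\<not> inj_on b {1..Q0}"
  proof
    assume "inj_on b {1..Q0}"
    then have "card {1..Q0} \<le> card {1..Q}" using b(1) by (intro card_inj_on_le) auto
    then show False using assms by simp
  qed
  then obtain q r where qr: "q \<in> {1..Q0}" "r \<in> {1..Q0}" "b q = b r" "p q < p r"
  proof -
    assume *: "\<And>q r. q \<in> {1..Q0} \<Longrightarrow> r \<in> {1..Q0} \<Longrightarrow> b q = b r \<Longrightarrow> p q < p r \<Longrightarrow> thesis"
    obtain q r where "q \<in> {1..Q0}" "r \<in> {1..Q0}" "b q = b r" "q \<noteq> r"
      using \<open>\<not> inj_on b {1..Q0}\<close> by (auto simp: inj_on_def)
    moreover from this have "p q \<noteq> p r" using sep[of q r] small by force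
    ultimately show thesis using *[of q r] *[of r q] by fastforce
  qed
  define l where "l = b q"
  have l: "l \<in> {1..Q}" using b(1) qr l_def by blast
  note Cl = class_props[OF l]
  let ?N = "\<lambda>q. {i \<in> {1..n}. z i = q}" and ?lo = "x (\<sigma> (\<iota> (l - 1) + 1))" and ?hi = "x (\<sigma> (\<iota> l))"
  have sub: "?N q \<subseteq> C l" "?N r \<subseteq> C l" using b(2)[OF l] qr(3) by (auto simp: l_def)
  have gap: "p q + \<delta> \<le> p r" using sep[OF qr(1,2)] qr(4) by fastforce
  have q_near: "\<bar>x i - p q\<bar> \<le> s" if "i \<in> ?N q" for i using close[of i] that by auto
  have r_near: "\<bar>x i - p r\<bar> \<le> s" if "i \<in> ?N r" for i using close[of i] that by auto
  obtain i j where ij: "i \<in> ?N q" "j \<in> ?N r" using label_ex qr(1,2) by blast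
  have lo: "?lo \<le> p q + s" using class_bounds(1)[OF l, of i] q_near[OF ij(1)] sub(1) ij(1) by force
  have hi: "p r - s \<le> ?hi" using class_bounds(2)[OF l, of j] r_near[OF ij(2)] sub(2) ij(2) by force
  \<comment> \<open>The proportions are known relative to \<open>n\<close>; relative to the smaller
    set \<open>C l\<close> they can only increase.\<close>
  have frac: "a * (\<delta> - 2 * s) \<le> real (card (?N t)) / real (card (C l)) * (\<delta> - 2 * s)"
    if "t \<in> {1..Q0}" for t
  proof (rule mult_right_mono)
    have pos: "0 < card (C l)" using Cl by (simp add: card_gt_0_iff)
    have "card (C l) \<le> n" using card_mono[OF _ Cl(3)] by simp
    then have "a * real (card (C l)) \<le> a * real n" using freq(1) by simp
    also have "\<dots> \<le> real (card (?N t))" using freq(2)[OF that] .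
    finally show "a \<le> real (card (?N t)) / real (card (C l))" using pos by (simp add: pos_le_divide_eq)
    show "0 \<le> \<delta> - 2 * s" using small by simp
  qed
  have "?lo + real (card (?N r)) / real (card (C l)) * (\<delta> - 2 * s) \<le> m l"
    unfolding class_mean_def
  proof (rule mean_ge[OF Cl(1,2) sub(2)])
    show "?lo \<le> x i" if "i \<in> C l" for i using class_bounds(1)[OF l that] .
    show "?lo + (\<delta> - 2 * s) \<le> x i" if "i \<in> ?N r" for i using r_near[OF that] lo gap by linarith
  qed
  moreover have "m l \<le> ?hi - real (card (?N q)) / real (card (C l)) * (\<delta> - 2 * s)"
    unfolding class_mean_def
  proof (rule mean_le[OF Cl(1,2) sub(1)])
    show "x i \<le> ?hi" if "i \<in> C l" for i using class_bounds(2)[OF l that] .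
    show "x i \<le> ?hi - (\<delta> - 2 * s)" if "i \<in> ?N q" for i using q_near[OF that] hi gap by linarith
  qed
  ultimately show ?thesis
    using frac[OF qr(1)] frac[OF qr(2)] by (intro excess_ge[OF l]) linarith+
qed

text \<open>No estimated class is empty, so \<open>b\<close> is onto, and hence injective between
  sets of equal size. Each estimated class then has a single label and spread at most
  \<open>2 * s\<close>.\<close>

lemma excess_le_exact:
  assumes "Q = Q0"
  shows "excess \<le> real (Q - 1) * (2 * (2 * s))"
proof -
  obtain b where "\<forall>q\<in>{1..Q0}. b q \<in> {1..Q}" "\<forall>l\<in>{1..Q}. \<forall>i\<in>{1..n}. i \<in> C l \<longleftrightarrow> b (z i) = l"
    using label_class[OF eq_refl[OF assms]] by blast
  note b = this[rule_format]
  have "{1..Q} \<subseteq> b ` {1..Q0}"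
  proof
    fix l assume l: "l \<in> {1..Q}"
    then obtain i where "i \<in> C l" "i \<in> {1..n}" using class_props(2,3)[OF l] by blast
    then show "l \<in> b ` {1..Q0}" using b(2)[OF l] label by blast
  qed
  then have "b ` {1..Q0} = {1..Q0}" using b(1) assms by blast
  then have inj: "inj_on b {1..Q0}" by (intro eq_card_imp_inj_on) auto
  show ?thesis
  proof (rule excess_le)
    fix l i j assume l: "l \<in> {1..Q}" and ij: "i \<in> C l" "j \<in> C l"
    then have n: "i \<in> {1..n}" "j \<in> {1..n}" using class_props(3)[OF l] by auto
    then have "b (z i) = b (z j)" using b(2)[OF l] ij by simp
    then have "z i = z j" using inj label n by (meson inj_onD)
    then show "x i - x j \<le> 2 * s" using same_label_close n by blast
  qed
qed

lemma criterion_under: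
  "Q < Q0 \<Longrightarrow> ereal (a * (\<delta> - 2 * s)) \<le> lg_criterion \<beta> n x Q C"
  by (intro criterion_ge excess_ge_merged)

lemma criterion_over:
  "Q0 < Q \<Longrightarrow> ereal (1 / (real n powr ((1 - \<beta>) / 2) * (2 * s))) \<le> lg_criterion \<beta> n x Q C"
  using small by (intro criterion_ge_inverse last_gap_le) auto

lemma criterion_exact:
  assumes "Q = Q0"
  shows "0 \<le> lg_criterion \<beta> n x Q C"
    and "lg_criterion \<beta> n x Q C \<le>
      ereal (4 * real Q0 * s + 1 / (real n powr ((1 - \<beta>) / 2) * (\<delta> - 2 * s)))"
proof -
  show "0 \<le> lg_criterion \<beta> n x Q C" using criterion_ge[OF excess_nonneg, of \<beta>] by (simp add: zero_ereal_def)
  have "excess \<le> real (Q - 1) * (4 * s)" using excess_le_exact[OF assms] by simp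
  also have "\<dots> \<le> real Q0 * (4 * s)" using small assms by (intro mult_right_mono) auto
  finally show "lg_criterion \<beta> n x Q C \<le>
      ereal (4 * real Q0 * s + 1 / (real n powr ((1 - \<beta>) / 2) * (\<delta> - 2 * s)))"
    using small assms last_gap_ge by (intro criterion_le) auto
qed

end

section \<open>Concentration in the stochastic block model\<close>

lemma integral_of_bool_bernoulli:
  assumes "Y \<in> measurable M (count_space UNIV)" "0 \<le> p" "p \<le> 1"
    and "distr M (count_space UNIV) Y = measure_pmf (bernoulli_pmf p)"
  shows "(\<integral>\<omega>. of_bool (Y \<omega>) \<partial>M) = (p :: real)"
proof -
  have "(\<integral>\<omega>. of_bool (Y \<omega>) \<partial>M) = (\<integral>b. of_bool b \<partial>distr M (count_space UNIV) Y :: real)"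
    using assms(1) by (subst integral_distr) auto
  also have "\<dots> = (\<integral>b. of_bool b \<partial>measure_pmf (bernoulli_pmf p))" using assms(4) by simp
  also have "\<dots> = p" using assms(2,3) by simp
  finally show ?thesis .
qed

text \<open>For variables in \<open>[0,1]\<close> the squared ranges add up to
  \<open>card I\<close>; taking the deviation proportional to \<open>card I\<close> cancels one such
  factor in the exponent.\<close>

lemma (in prob_space) Hoeffding_of_bool:
  fixes B :: "'b \<Rightarrow> 'a \<Rightarrow> bool"
  assumes "finite I" "I \<noteq> {}" "indep_vars (\<lambda>_. count_space UNIV) B I" "0 \<le> t"
  shows "prob {\<omega> \<in> space M. t * real (card I) \<le>
      \<bar>(\<Sum>i\<in>I. of_bool (B i \<omega>)) - (\<Sum>i\<in>I. expectation (\<lambda>\<omega>. of_bool (B i \<omega>)))\<bar>}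
    \<le> 2 * exp (- 2 * real (card I) * t\<^sup>2)"
proof -
  have ind: "indep_vars (\<lambda>_. borel) (\<lambda>i \<omega>. of_bool (B i \<omega>) :: real) I"
    by (rule indep_vars_compose2[OF assms(3)]) auto
  interpret H: Hoeffding_ineq M I "\<lambda>i \<omega>. of_bool (B i \<omega>)" "\<lambda>_. 0" "\<lambda>_. 1"
    "\<Sum>i\<in>I. expectation (\<lambda>\<omega>. of_bool (B i \<omega>))"
    by unfold_locales (use assms(1) ind in auto)
  have pos: "0 < real (card I)" using assms(1,2) by (simp add: card_gt_0_iff)
  have "- 2 * (t * real (card I))\<^sup>2 / (\<Sum>i\<in>I. (1 - 0)\<^sup>2) = - 2 * real (card I) * t\<^sup>2"
    using pos by (simp add: power2_eq_square)
  then show ?thesis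
    using H.Hoeffding_ineq_abs_ge[of "t * real (card I)"] pos assms(4) by simp
qed

text \<open>The law of total probability in the form of an upper bound. The event \<open>B z\<close>
  may vary with the atom; null atoms contribute nothing, so a conditional bound is asked only on
  atoms of positive probability.\<close>

lemma (in prob_space) prob_partition_le:
  assumes "finite S" "\<And>z. z \<in> S \<Longrightarrow> L z \<in> events" "disjoint_family_on L S"
    and "\<And>z. z \<in> S \<Longrightarrow> B z \<in> events" "0 \<le> c"
    and "\<And>z. z \<in> S \<Longrightarrow> 0 < prob (L z) \<Longrightarrow> measure (uniform_measure M (L z)) (B z) \<le> c"
  shows "prob (\<Union>z\<in>S. L z \<inter> B z) \<le> c"
proof -
  have le: "prob (L z \<inter> B z) \<le> c * prob (L z)" if z: "z \<in> S" for z
  proof (cases "prob (L z) = 0")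
    case True
    then have "prob (L z \<inter> B z) \<le> 0"
      using finite_measure_mono[of "L z \<inter> B z" "L z"] assms(2)[OF z] by simp
    then show ?thesis using True by simp
  next
    case False
    then have pos: "0 < prob (L z)" by (simp add: zero_less_measure_iff)
    then have "prob (L z \<inter> B z) / prob (L z) \<le> c"
      using assms(6)[OF z pos] assms(2,4)[OF z] by (simp add: emeasure_eq_measure)
    then show ?thesis using pos by (simp add: pos_divide_le_eq)
  qed
  have "prob (\<Union>z\<in>S. L z \<inter> B z) \<le> (\<Sum>z\<in>S. prob (L z \<inter> B z))"
    using assms(1,2,4) by (intro finite_measure_subadditive_finite) auto
  also have "\<dots> \<le> (\<Sum>z\<in>S. c * prob (L z))" by (intro sum_mono le)
  also have "\<dots> = c * prob (\<Union>z\<in>S. L z)"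
    using assms(1,2,3) by (simp add: sum_distrib_left finite_measure_finite_Union image_subset_iff)
  also have "\<dots> \<le> c" using assms(5) by (simp add: mult_left_le)
  finally show ?thesis .
qed

text \<open>The mean degree given the labels depends only on the label counts. Replacing them by
  \<open>real n * \<alpha> r\<close> costs \<open>real n * t\<close> per label, and leaving out node
  \<open>i\<close> costs at most 1, which \<open>real n * t\<close> absorbs.\<close>

lemma mean_degree_close:
  fixes \<pi> :: "nat \<Rightarrow> nat \<Rightarrow> real"
  assumes "2 \<le> n" "i \<in> {1..n}" "\<And>j. j \<in> {1..n} \<Longrightarrow> z j \<in> {1..Q0}"
    and \<pi>: "\<And>q r. q \<in> {1..Q0} \<Longrightarrow> r \<in> {1..Q0} \<Longrightarrow> 0 \<le> \<pi> q r \<and> \<pi> q r \<le> 1"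
    and \<alpha>: "\<And>q. q \<in> {1..Q0} \<Longrightarrow> 0 \<le> \<alpha> q" "(\<Sum>q = 1..Q0. \<alpha> q) = 1"
    and N: "\<And>q. q \<in> {1..Q0} \<Longrightarrow> \<bar>real (card {j \<in> {1..n}. z j = q}) - real n * \<alpha> q\<bar> \<le> real n * t"
    and t: "1 \<le> real n * t"
  shows "\<bar>(\<Sum>j\<in>{1..n} - {i}. \<pi> (z i) (z j)) / (real n - 1) - (\<Sum>r = 1..Q0. \<alpha> r * \<pi> (z i) r)\<bar>
    \<le> (2 * real Q0 + 2) * t"
proof -
  define q where "q = z i"
  have q: "q \<in> {1..Q0}" using assms(2,3) by (simp add: q_def)
  let ?N = "\<lambda>r. real (card {j \<in> {1..n}. z j = r})"
  define P where "P = (\<Sum>r = 1..Q0. \<alpha> r * \<pi> q r)"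
  define S where "S = (\<Sum>j\<in>{1..n} - {i}. \<pi> q (z j))"
  have t0: "0 \<le> t"
  proof (rule ccontr)
    assume "\<not> 0 \<le> t"
    then have "real n * t \<le> 0" by (simp add: mult_nonneg_nonpos)
    then show False using t by simp
  qed
  have P01: "0 \<le> P" "P \<le> 1"
  proof -
    show "0 \<le> P" unfolding P_def using \<alpha>(1) \<pi>[OF q] by (intro sum_nonneg) simp
    have "P \<le> (\<Sum>r = 1..Q0. \<alpha> r)"
      unfolding P_def using \<alpha>(1) \<pi>[OF q] by (intro sum_mono) (simp add: mult_left_le)
    then show "P \<le> 1" using \<alpha>(2) by simp
  qed
  have "(\<Sum>j\<in>{1..n}. \<pi> q (z j)) = (\<Sum>r\<in>{1..Q0}. \<Sum>j\<in>{j \<in> {1..n}. z j = r}. \<pi> q (z j))"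
    using assms(3) by (intro sum.group[symmetric]) auto
  also have "\<dots> = (\<Sum>r\<in>{1..Q0}. ?N r * \<pi> q r)" by (intro sum.cong) auto
  finally have all: "(\<Sum>j\<in>{1..n}. \<pi> q (z j)) = (\<Sum>r\<in>{1..Q0}. ?N r * \<pi> q r)" .
  have "S = (\<Sum>j\<in>{1..n}. \<pi> q (z j)) - \<pi> q (z i)"
    unfolding S_def using assms(2) by (simp add: sum_diff1)
  also have "\<dots> = (\<Sum>r = 1..Q0. ?N r * \<pi> q r) - \<pi> q q" by (simp only: all flip: q_def)
  finally have "S = (\<Sum>r = 1..Q0. ?N r * \<pi> q r) - \<pi> q q" .
  moreover have "(\<Sum>r = 1..Q0. (?N r - real n * \<alpha> r) * \<pi> q r)
      = (\<Sum>r = 1..Q0. ?N r * \<pi> q r) - real n * P"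
    by (simp only: P_def sum_distrib_left sum_subtractf left_diff_distrib mult.assoc)
  \<comment> \<open>The term \<open>P - \<pi> q q\<close> is the correction for the missing loop at
    \<open>i\<close> and for the \<open>n - 1\<close> summands instead of \<open>n\<close>.\<close>
  ultimately have S: "S - (real n - 1) * P
      = (\<Sum>r = 1..Q0. (?N r - real n * \<alpha> r) * \<pi> q r) + (P - \<pi> q q)"
    by (simp add: algebra_simps)
  have "\<bar>\<Sum>r = 1..Q0. (?N r - real n * \<alpha> r) * \<pi> q r\<bar> \<le> (\<Sum>r = 1..Q0. real n * t)"
  proof (rule order_trans[OF sum_abs sum_mono])
    fix r assume r: "r \<in> {1..Q0}"
    have "\<bar>?N r - real n * \<alpha> r\<bar> * \<bar>\<pi> q r\<bar> \<le> (real n * t) * 1"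
      using N[OF r] \<pi>[OF q r] t by (intro mult_mono) auto
    then show "\<bar>(?N r - real n * \<alpha> r) * \<pi> q r\<bar> \<le> real n * t" by (simp add: abs_mult)
  qed
  moreover have "\<bar>P - \<pi> q q\<bar> \<le> 1" using P01 \<pi>[OF q q] by auto
  ultimately have dev: "\<bar>S - (real n - 1) * P\<bar> \<le> real Q0 * (real n * t) + real n * t"
    unfolding S using t by simp
  also have "\<dots> = (real Q0 + 1) * t * real n" by (simp add: algebra_simps)
  \<comment> \<open>The inequality \<open>n \<le> 2 * (n - 1)\<close> passes to the normalization by
    \<open>n - 1\<close> and doubles the constant.\<close>
  also have "\<dots> \<le> (real Q0 + 1) * t * (2 * (real n - 1))"
    using assms(1) t0 by (intro mult_left_mono mult_nonneg_nonneg) auto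
  finally have "\<bar>S - (real n - 1) * P\<bar> \<le> ((2 * real Q0 + 2) * t) * (real n - 1)"
    by (simp add: algebra_simps)
  moreover have "S / (real n - 1) - P = (S - (real n - 1) * P) / (real n - 1)"
    using assms(1) by (simp add: diff_divide_distrib)
  ultimately have "\<bar>S / (real n - 1) - P\<bar> \<le> (2 * real Q0 + 2) * t"
    using assms(1) by (simp add: pos_divide_le_eq)
  then show ?thesis by (simp add: S_def P_def q_def)
qed

section \<open>Deviation bounds for one graph of fixed size\<close>

locale sbm = prob_space M for M :: "'a measure" +
  fixes n Q0 :: nat and \<pi> :: "nat \<Rightarrow> nat \<Rightarrow> real" and \<alpha> :: "nat \<Rightarrow> real"
    and Z :: "'a \<Rightarrow> nat \<Rightarrow> nat" and X :: "'a \<Rightarrow> nat \<Rightarrow> nat \<Rightarrow> bool"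
  assumes n: "2 \<le> n"
    and model: "stochastic_block_model M n Q0 \<pi> \<alpha> Z X"
    and \<pi>_sym: "\<And>q r. q \<in> {1..Q0} \<Longrightarrow> r \<in> {1..Q0} \<Longrightarrow> \<pi> q r = \<pi> r q"
    and \<pi>_bounds: "\<And>q r. q \<in> {1..Q0} \<Longrightarrow> r \<in> {1..Q0} \<Longrightarrow> 0 \<le> \<pi> q r \<and> \<pi> q r \<le> 1"
    and \<alpha>_nonneg: "\<And>q. q \<in> {1..Q0} \<Longrightarrow> 0 \<le> \<alpha> q"
    and \<alpha>_sum: "(\<Sum>q = 1..Q0. \<alpha> q) = 1"
begin

lemma Z_indep: "indep_vars (\<lambda>_. count_space {1..Q0}) (\<lambda>i \<omega>. Z \<omega> i) {1..n}"
  using model unfolding stochastic_block_model_def by blast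

lemma Z_measurable: "i \<in> {1..n} \<Longrightarrow> (\<lambda>\<omega>. Z \<omega> i) \<in> measurable M (count_space {1..Q0})"
  using Z_indep unfolding indep_vars_def by blast

lemma Z_in: "i \<in> {1..n} \<Longrightarrow> \<omega> \<in> space M \<Longrightarrow> Z \<omega> i \<in> {1..Q0}"
  using measurable_space[OF Z_measurable] by simp

lemma Z_pred: "i \<in> {1..n} \<Longrightarrow> {\<omega> \<in> space M. Z \<omega> i = q} \<in> events"
proof -
  assume i: "i \<in> {1..n}"
  \<comment> \<open>The value \<open>q\<close> is arbitrary; outside \<open>{1..Q0}\<close> the
    event is empty.\<close>
  have "(\<lambda>\<omega>. Z \<omega> i) -` ({q} \<inter> {1..Q0}) \<inter> space M \<in> events"
    by (rule measurable_sets[OF Z_measurable[OF i]]) simp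
  moreover have "(\<lambda>\<omega>. Z \<omega> i) -` ({q} \<inter> {1..Q0}) \<inter> space M = {\<omega> \<in> space M. Z \<omega> i = q}"
    using Z_in[OF i] by auto
  ultimately show ?thesis by simp
qed

lemma X_measurable [measurable]:
  "i \<in> {1..n} \<Longrightarrow> j \<in> {1..n} \<Longrightarrow> (\<lambda>\<omega>. X \<omega> i j) \<in> measurable M (count_space UNIV)"
  using model unfolding stochastic_block_model_def by blast

lemma label_event_measurable: "label_event M n Z z \<in> events"
proof -
  show ?thesis
    unfolding label_event_def by (rule sets.sets_Collect_finite_All[OF Z_pred]) auto
qed

text \<open>The centre is the conditional mean of the degree given the labels. They enter as a fixed
  vector \<open>z\<close>, so that it is a constant on each atom.\<close>

definition dev :: "(nat \<Rightarrow> nat) \<Rightarrow> nat \<Rightarrow> real \<Rightarrow> 'a set" where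
  "dev z i t = {\<omega> \<in> space M. t \<le> \<bar>norm_degree n (X \<omega>) i
     - (\<Sum>j\<in>{1..n} - {i}. \<pi> (z i) (z j)) / (real n - 1)\<bar>}"

lemma norm_degree_measurable:
  "i \<in> {1..n} \<Longrightarrow> (\<lambda>\<omega>. norm_degree n (X \<omega>) i) \<in> borel_measurable M"
  unfolding norm_degree_def by measurable

lemma dev_measurable: "i \<in> {1..n} \<Longrightarrow> dev z i t \<in> events"
  unfolding dev_def using norm_degree_measurable by measurable

text \<open>Given the labels, the \<open>n - 1\<close> potential edges at node \<open>i\<close> are
  independent Bernoulli variables, to which Hoeffding's inequality applies.\<close>

lemma conditional_dev_le:
  assumes z: "z \<in> {1..n} \<rightarrow> {1..Q0}" and pos: "0 < prob (label_event M n Z z)"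
    and i: "i \<in> {1..n}" and t: "0 \<le> t"
  shows "measure (uniform_measure M (label_event M n Z z)) (dev z i t)
    \<le> 2 * exp (- 2 * (real n - 1) * t\<^sup>2)"
proof -
  let ?U = "uniform_measure M (label_event M n Z z)"
  interpret U: prob_space ?U
    using pos by (intro prob_space_uniform_measure) (auto simp: emeasure_eq_measure)
  \<comment> \<open>The model states independence over pairs with increasing entries, so the edge
    between \<open>i\<close> and \<open>j\<close> is indexed by its ordered pair; symmetry of
    \<open>X\<close> and \<open>\<pi>\<close> translates back.\<close>
  define pr where "pr j = (min i j, max i j)" for j
  let ?J = "{1..n} - {i}" and ?E = "{(i, j). 1 \<le> i \<and> i < j \<and> j \<le> n}"
  have "U.indep_vars (\<lambda>_. count_space UNIV) (\<lambda>(i, j) \<omega>. X \<omega> i j) ?E"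
    using model z pos unfolding stochastic_block_model_def by blast
  moreover have sub: "pr ` ?J \<subseteq> ?E" using i by (auto simp: pr_def)
  ultimately have ind: "U.indep_vars (\<lambda>_. count_space UNIV) (\<lambda>(i, j) \<omega>. X \<omega> i j) (pr ` ?J)"
    by (rule U.indep_vars_subset)
  have inj: "inj_on pr ?J" by (auto simp: inj_on_def pr_def min_def max_def split: if_splits)
  have X_pr: "(case pr j of (i, j) \<Rightarrow> \<lambda>\<omega>. X \<omega> i j) \<omega> = X \<omega> i j" if "\<omega> \<in> space M" "j \<in> ?J" for \<omega> j
    using model i that unfolding stochastic_block_model_def
    by (auto simp: pr_def min_def max_def)
  have mean: "U.expectation (\<lambda>\<omega>. of_bool ((case pr j of (i, j) \<Rightarrow> \<lambda>\<omega>. X \<omega> i j) \<omega>)) = \<pi> (z i) (z j)"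
    if j: "j \<in> ?J" for j
  proof -
    define u v where "u = min i j" and "v = max i j"
    then have "pr j = (u, v)" "1 \<le> u" "v \<le> n"
      using i j by (simp_all add: pr_def)
    moreover have "u < v" using j unfolding u_def v_def by (simp add: min_def max_def)
    ultimately have uv: "pr j = (u, v)" "1 \<le> u" "u < v" "v \<le> n" by simp_all
    have swap: "u = i \<and> v = j \<or> u = j \<and> v = i"
      unfolding u_def v_def min_def max_def by simp
    have zz: "z u \<in> {1..Q0}" "z v \<in> {1..Q0}" using z uv by auto
    have sym: "\<pi> (z u) (z v) = \<pi> (z i) (z j)"
      using swap \<pi>_sym[OF zz] by (elim disjE) simp_all
    have "distr ?U (count_space UNIV) (\<lambda>\<omega>. X \<omega> u v) = measure_pmf (bernoulli_pmf (\<pi> (z u) (z v)))"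
      using model z pos uv unfolding stochastic_block_model_def by blast
    moreover have "(\<lambda>\<omega>. X \<omega> u v) \<in> measurable ?U (count_space UNIV)"
      using X_measurable[of u v] uv by (simp add: measurable_cong_sets[OF sets_uniform_measure refl])
    ultimately have "U.expectation (\<lambda>\<omega>. of_bool (X \<omega> u v)) = \<pi> (z u) (z v)"
      using \<pi>_bounds[OF zz] by (intro integral_of_bool_bernoulli) auto
    then show ?thesis using uv(1) sym by simp
  qed
  have card: "card (pr ` ?J) = n - 1" using i inj by (simp add: card_image)
  have "pr ` ?J \<noteq> {}"
  proof
    assume "pr ` ?J = {}"
    then show False using card n by (simp only: card.empty)
  qed
  from U.Hoeffding_of_bool[OF _ this ind t]
  have "U.prob {\<omega> \<in> space M. t * real (n - 1) \<le>
      \<bar>(\<Sum>e\<in>pr ` ?J. of_bool ((case e of (i, j) \<Rightarrow> \<lambda>\<omega>. X \<omega> i j) \<omega>))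
        - (\<Sum>e\<in>pr ` ?J. U.expectation (\<lambda>\<omega>. of_bool ((case e of (i, j) \<Rightarrow> \<lambda>\<omega>. X \<omega> i j) \<omega>)))\<bar>}
    \<le> 2 * exp (- 2 * real (n - 1) * t\<^sup>2)"
    unfolding card by simp
  also have "{\<omega> \<in> space M. t * real (n - 1) \<le>
      \<bar>(\<Sum>e\<in>pr ` ?J. of_bool ((case e of (i, j) \<Rightarrow> \<lambda>\<omega>. X \<omega> i j) \<omega>))
        - (\<Sum>e\<in>pr ` ?J. U.expectation (\<lambda>\<omega>. of_bool ((case e of (i, j) \<Rightarrow> \<lambda>\<omega>. X \<omega> i j) \<omega>)))\<bar>}
    = dev z i t"
  proof -
    have "(t * real (n - 1) \<le>
      \<bar>(\<Sum>e\<in>pr ` ?J. of_bool ((case e of (i, j) \<Rightarrow> \<lambda>\<omega>. X \<omega> i j) \<omega>))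
        - (\<Sum>e\<in>pr ` ?J. U.expectation (\<lambda>\<omega>. of_bool ((case e of (i, j) \<Rightarrow> \<lambda>\<omega>. X \<omega> i j) \<omega>)))\<bar>)
      \<longleftrightarrow> t \<le> \<bar>norm_degree n (X \<omega>) i - (\<Sum>j\<in>?J. \<pi> (z i) (z j)) / (real n - 1)\<bar>"
      if \<omega>: "\<omega> \<in> space M" for \<omega>
    proof -
      have "(\<Sum>e\<in>pr ` ?J. of_bool ((case e of (i, j) \<Rightarrow> \<lambda>\<omega>. X \<omega> i j) \<omega>)) = (\<Sum>j\<in>?J. of_bool (X \<omega> i j) :: real)"
        unfolding sum.reindex[OF inj] comp_def using X_pr[OF \<omega>] by (intro sum.cong refl) simp
      moreover have "(\<Sum>e\<in>pr ` ?J. U.expectation (\<lambda>\<omega>. of_bool ((case e of (i, j) \<Rightarrow> \<lambda>\<omega>. X \<omega> i j) \<omega>)))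
          = (\<Sum>j\<in>?J. \<pi> (z i) (z j))"
        unfolding sum.reindex[OF inj] comp_def using mean by (intro sum.cong refl)
      moreover have "norm_degree n (X \<omega>) i - (\<Sum>j\<in>?J. \<pi> (z i) (z j)) / (real n - 1)
          = ((\<Sum>j\<in>?J. of_bool (X \<omega> i j)) - (\<Sum>j\<in>?J. \<pi> (z i) (z j))) / (real n - 1)"
        by (simp add: norm_degree_def diff_divide_distrib)
      ultimately show ?thesis using n by (simp add: pos_le_divide_eq of_nat_diff)
    qed
    then show ?thesis unfolding dev_def by blast
  qed
  finally show ?thesis using n by (simp add: of_nat_diff)
qed

lemma label_count_dev_le:
  assumes q: "q \<in> {1..Q0}" and t: "0 \<le> t"
  shows "{\<omega> \<in> space M. real n * t \<le> \<bar>real (card {i \<in> {1..n}. Z \<omega> i = q}) - real n * \<alpha> q\<bar>} \<in> events"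
    and "prob {\<omega> \<in> space M. real n * t \<le> \<bar>real (card {i \<in> {1..n}. Z \<omega> i = q}) - real n * \<alpha> q\<bar>}
      \<le> 2 * exp (- 2 * (real n - 1) * t\<^sup>2)"
proof -
  have ind: "indep_vars (\<lambda>_. count_space UNIV) (\<lambda>i \<omega>. Z \<omega> i = q) {1..n}"
    by (rule indep_vars_compose2[OF Z_indep]) auto
  have count: "real (card {i \<in> {1..n}. Z \<omega> i = q}) = (\<Sum>i\<in>{1..n}. of_bool (Z \<omega> i = q))" for \<omega>
    by (simp add: of_bool_def sum.If_cases Int_def)
  have meas: "(\<lambda>\<omega>. of_bool (Z \<omega> i = q) :: real) \<in> borel_measurable M" if "i \<in> {1..n}" for i
    using Z_pred[OF that] by measurable
  show "{\<omega> \<in> space M. real n * t \<le> \<bar>real (card {i \<in> {1..n}. Z \<omega> i = q}) - real n * \<alpha> q\<bar>} \<in> events"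
    unfolding count using meas by measurable
  have "expectation (\<lambda>\<omega>. of_bool (Z \<omega> i = q)) = \<alpha> q" if i: "i \<in> {1..n}" for i
  proof -
    have "expectation (\<lambda>\<omega>. of_bool (Z \<omega> i = q)) = expectation (indicator {\<omega> \<in> space M. Z \<omega> i = q})"
      by (intro Bochner_Integration.integral_cong) (auto simp: indicator_def)
    also have "\<dots> = prob {\<omega> \<in> space M. Z \<omega> i = q}"
      using Z_pred[OF i] by simp
    also have "\<dots> = \<alpha> q" using model i q unfolding stochastic_block_model_def by blast
    finally show ?thesis .
  qed
  then have mean: "(\<Sum>i\<in>{1..n}. expectation (\<lambda>\<omega>. of_bool (Z \<omega> i = q))) = real n * \<alpha> q" by simp
  have "prob {\<omega> \<in> space M. real n * t \<le> \<bar>real (card {i \<in> {1..n}. Z \<omega> i = q}) - real n * \<alpha> q\<bar>}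
      \<le> 2 * exp (- 2 * real n * t\<^sup>2)"
    using Hoeffding_of_bool[OF _ _ ind t] n unfolding count mean by (simp add: mult.commute)
  \<comment> \<open>The exponent is weakened to match the bound for the degrees, so that one union
    bound covers both.\<close>
  also have "\<dots> \<le> 2 * exp (- 2 * (real n - 1) * t\<^sup>2)" by (simp add: algebra_simps)
  finally show "prob {\<omega> \<in> space M. real n * t \<le> \<bar>real (card {i \<in> {1..n}. Z \<omega> i = q}) - real n * \<alpha> q\<bar>}
      \<le> 2 * exp (- 2 * (real n - 1) * t\<^sup>2)" .
qed

text \<open>This is the event that the degree of \<open>i\<close> is far from its mean given the
  actual labels. Splitting it over the finitely many label vectors gives measurability and prepares
  conditioning; extensional vectors make the atoms of distinct vectors disjoint.\<close>

definition degree_dev :: "nat \<Rightarrow> real \<Rightarrow> 'a set" where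
  "degree_dev i t = (\<Union>z\<in>{1..n} \<rightarrow>\<^sub>E {1..Q0}. label_event M n Z z \<inter> dev z i t)"

definition count_dev :: "nat \<Rightarrow> real \<Rightarrow> 'a set" where
  "count_dev q t =
    {\<omega> \<in> space M. real n * t \<le> \<bar>real (card {i \<in> {1..n}. Z \<omega> i = q}) - real n * \<alpha> q\<bar>}"

definition bad_event :: "real \<Rightarrow> 'a set" where
  "bad_event t = (\<Union>i\<in>{1..n}. degree_dev i t) \<union> (\<Union>q\<in>{1..Q0}. count_dev q t)"

lemma degree_dev_le:
  assumes i: "i \<in> {1..n}" and t: "0 \<le> t"
  shows "degree_dev i t \<in> events" "prob (degree_dev i t) \<le> 2 * exp (- 2 * (real n - 1) * t\<^sup>2)"
proof -
  let ?S = "{1..n} \<rightarrow>\<^sub>E {1..Q0}" and ?L = "label_event M n Z"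
  have fin: "finite ?S" by (intro finite_PiE) auto
  show "degree_dev i t \<in> events"
    unfolding degree_dev_def
    using fin label_event_measurable dev_measurable[OF i] by (intro sets.finite_UN sets.Int) auto
  show "prob (degree_dev i t) \<le> 2 * exp (- 2 * (real n - 1) * t\<^sup>2)"
    unfolding degree_dev_def
  proof (rule prob_partition_le[OF fin label_event_measurable _ dev_measurable[OF i]])
    show "disjoint_family_on ?L ?S"
      unfolding disjoint_family_on_def
    proof (intro ballI impI)
      fix z z' assume z: "z \<in> ?S" "z' \<in> ?S" "z \<noteq> z'"
      then obtain k where "k \<in> {1..n}" "z k \<noteq> z' k" using PiE_ext[of z _ _ z'] by metis
      then show "?L z \<inter> ?L z' = {}" unfolding label_event_def by force
    qed
    show "measure (uniform_measure M (?L z)) (dev z i t) \<le> 2 * exp (- 2 * (real n - 1) * t\<^sup>2)"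
      if "z \<in> ?S" "0 < prob (?L z)" for z
      using conditional_dev_le[OF _ that(2) i t] that(1) by (auto simp: PiE_def)
  qed simp
qed

lemma bad_event_le:
  assumes t: "0 \<le> t"
  shows "bad_event t \<in> events"
    and "prob (bad_event t) \<le> 2 * (real n + real Q0) * exp (- 2 * (real n - 1) * t\<^sup>2)"
proof -
  let ?c = "2 * exp (- 2 * (real n - 1) * t\<^sup>2)"
  let ?A = "\<lambda>i. degree_dev i t" and ?B = "\<lambda>q. count_dev q t"
  note A = degree_dev_le[OF _ t] and B = label_count_dev_le[OF _ t, folded count_dev_def]
  have U: "(\<Union>i\<in>{1..n}. ?A i) \<in> events" "(\<Union>q\<in>{1..Q0}. ?B q) \<in> events"
    using A(1) B(1) by (auto intro!: sets.finite_UN)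
  then show "bad_event t \<in> events" unfolding bad_event_def by (rule sets.Un)
  have "prob (\<Union>i\<in>{1..n}. ?A i) \<le> (\<Sum>i\<in>{1..n}. prob (?A i))"
    by (rule finite_measure_subadditive_finite) (use A(1) in auto)
  also have "\<dots> \<le> (\<Sum>i\<in>{1..n}. ?c)" by (rule sum_mono) (rule A(2))
  finally have UA: "prob (\<Union>i\<in>{1..n}. ?A i) \<le> real n * ?c" by simp
  have "prob (\<Union>q\<in>{1..Q0}. ?B q) \<le> (\<Sum>q\<in>{1..Q0}. prob (?B q))"
    by (rule finite_measure_subadditive_finite) (use B(1) in auto)
  also have "\<dots> \<le> (\<Sum>q\<in>{1..Q0}. ?c)" by (rule sum_mono) (rule B(2))
  finally have UB: "prob (\<Union>q\<in>{1..Q0}. ?B q) \<le> real Q0 * ?c" by simp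
  have "prob (bad_event t) \<le> real n * ?c + real Q0 * ?c"
    using measure_Un_le[OF U] UA UB unfolding bad_event_def by linarith
  then show "prob (bad_event t) \<le> 2 * (real n + real Q0) * exp (- 2 * (real n - 1) * t\<^sup>2)"
    by (simp add: algebra_simps)
qed

lemma count_close:
  assumes "\<omega> \<in> space M - bad_event t" "q \<in> {1..Q0}"
  shows "\<bar>real (card {i \<in> {1..n}. Z \<omega> i = q}) - real n * \<alpha> q\<bar> \<le> real n * t"
proof -
  have "\<omega> \<in> space M" "\<omega> \<notin> count_dev q t" using assms by (auto simp: bad_event_def)
  then show ?thesis by (simp add: count_dev_def)
qed

text \<open>The constant collects \<open>t\<close> from the edges given the labels and
  \<open>(2 * real Q0 + 2) * t\<close> from the label counts.\<close>

lemma degree_close: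
  assumes t: "1 \<le> real n * t" and \<omega>: "\<omega> \<in> space M - bad_event t" and i: "i \<in> {1..n}"
  shows "\<bar>norm_degree n (X \<omega>) i - (\<Sum>r = 1..Q0. \<alpha> r * \<pi> (Z \<omega> i) r)\<bar> \<le> (2 * real Q0 + 3) * t"
proof -
  \<comment> \<open>The actual labels are restricted so that they become one of the extensional
    vectors in \<open>degree_dev\<close>.\<close>
  let ?z = "restrict (Z \<omega>) {1..n}" and ?\<mu> = "(\<Sum>j\<in>{1..n} - {i}. \<pi> (Z \<omega> i) (Z \<omega> j)) / (real n - 1)"
  have "?z \<in> {1..n} \<rightarrow>\<^sub>E {1..Q0}" using Z_in \<omega> by auto
  moreover have "\<omega> \<in> label_event M n Z ?z" using \<omega> by (simp add: label_event_def)
  moreover have "\<omega> \<notin> degree_dev i t" using \<omega> i by (auto simp: bad_event_def)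
  ultimately have "\<omega> \<notin> dev ?z i t" unfolding degree_dev_def by blast
  then have "\<bar>norm_degree n (X \<omega>) i - ?\<mu>\<bar> < t" using \<omega> i by (simp add: dev_def not_le)
  moreover have "\<bar>?\<mu> - (\<Sum>r = 1..Q0. \<alpha> r * \<pi> (Z \<omega> i) r)\<bar> \<le> (2 * real Q0 + 2) * t"
    by (rule mean_degree_close[OF n i _ \<pi>_bounds \<alpha>_nonneg \<alpha>_sum count_close[OF \<omega>] t])
      (use Z_in \<omega> in auto)
  ultimately show ?thesis by (simp add: algebra_simps)
qed

text \<open>The bad event is hidden behind an existential so that one event per graph size can be
  chosen for Borel-Cantelli.\<close>

lemma concentration:
  assumes "1 \<le> real n * t" "0 \<le> t"
  shows "\<exists>E\<in>events. prob E \<le> 2 * (real n + real Q0) * exp (- 2 * (real n - 1) * t\<^sup>2) \<and>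
    (\<forall>\<omega>\<in>space M - E.
      (\<forall>i\<in>{1..n}. Z \<omega> i \<in> {1..Q0} \<and>
        \<bar>norm_degree n (X \<omega>) i - (\<Sum>r = 1..Q0. \<alpha> r * \<pi> (Z \<omega> i) r)\<bar> \<le> (2 * real Q0 + 3) * t) \<and>
      (\<forall>q\<in>{1..Q0}. \<bar>real (card {i \<in> {1..n}. Z \<omega> i = q}) - real n * \<alpha> q\<bar> \<le> real n * t))"
  using bad_event_le[OF assms(2)] degree_close[OF assms(1)] count_close Z_in
  by (intro bexI[of _ "bad_event t"] conjI ballI) auto

end

section \<open>Limits of the criterion\<close>

lemma finite_pos_lower_bound:
  fixes S :: "real set"
  assumes "finite S" "\<And>x. x \<in> S \<Longrightarrow> 0 < x"
  shows "\<exists>d>0. \<forall>x\<in>S. d \<le> x"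
proof (intro exI conjI ballI)
  \<comment> \<open>Inserting 1 keeps the minimum meaningful for empty \<open>S\<close>.\<close>
  show "0 < Min (insert 1 S)" using assms by (subst Min_gr_iff) auto
  show "Min (insert 1 S) \<le> x" if "x \<in> S" for x using assms(1) that by (intro Min_le) auto
qed

lemma summable_stretched_exp:
  assumes "0 < \<gamma>"
  shows "summable (\<lambda>n. 2 * (real n + c) * exp (- (real n powr \<gamma>)))"
proof (rule summable_comparison_test_bigo)
  show "summable (\<lambda>n. norm (inverse (real n ^ 2)))"
    using inverse_power_summable[of 2, where ?'a = real] by simp
  show "(\<lambda>n. 2 * (real n + c) * exp (- (real n powr \<gamma>))) \<in> O(\<lambda>n. inverse (real n ^ 2))"
    using assms by real_asymp
qed

text \<open>The rate \<open>t\<close> is slow enough for the Hoeffding bounds to be summable, and is yet negligible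
  with respect to \<open>n powr (- (1 - \<beta>) / 2)\<close>, the scale on which the criterion weighs a gap.\<close>

lemma AE_sbm_concentrated:
  fixes X :: "nat \<Rightarrow> 'a \<Rightarrow> nat \<Rightarrow> nat \<Rightarrow> bool"
  assumes "\<And>n. 2 \<le> n \<Longrightarrow> sbm M n Q0 \<pi> \<alpha> (Z n) (X n)" and "0 < \<beta>"
  defines "t \<equiv> \<lambda>n. real n powr (\<beta> / 4 - 1 / 2)"
  shows "AE \<omega> in M. \<forall>\<^sub>F n in sequentially.
    (\<forall>i\<in>{1..n}. Z n \<omega> i \<in> {1..Q0} \<and>
      \<bar>norm_degree n (X n \<omega>) i - (\<Sum>r = 1..Q0. \<alpha> r * \<pi> (Z n \<omega> i) r)\<bar> \<le> (2 * real Q0 + 3) * t n) \<and>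
    (\<forall>q\<in>{1..Q0}. \<bar>real (card {i \<in> {1..n}. Z n \<omega> i = q}) - real n * \<alpha> q\<bar> \<le> real n * t n)"
proof -
  define good where "good n \<omega> \<longleftrightarrow>
    (\<forall>i\<in>{1..n}. Z n \<omega> i \<in> {1..Q0} \<and>
      \<bar>norm_degree n (X n \<omega>) i - (\<Sum>r = 1..Q0. \<alpha> r * \<pi> (Z n \<omega> i) r)\<bar> \<le> (2 * real Q0 + 3) * t n) \<and>
    (\<forall>q\<in>{1..Q0}. \<bar>real (card {i \<in> {1..n}. Z n \<omega> i = q}) - real n * \<alpha> q\<bar> \<le> real n * t n)" for n \<omega>
  interpret sbm2: sbm M 2 Q0 \<pi> \<alpha> "Z 2" "X 2" using assms(1)[of 2] by simp
  let ?b = "\<lambda>n. 2 * (real n + real Q0) * exp (- (real n powr (\<beta> / 2)))"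
  \<comment> \<open>The condition \<open>2 \<le> n\<close> is placed inside, so that a measurable
    event can be chosen for every \<open>n\<close>; below 2 it is arbitrary.\<close>
  have "\<exists>E. E \<in> sets M \<and> (2 \<le> n \<longrightarrow> measure M E \<le> ?b n \<and> (\<forall>\<omega>\<in>space M - E. good n \<omega>))" for n
  proof (cases "2 \<le> n")
    case True
    interpret S: sbm M n Q0 \<pi> \<alpha> "Z n" "X n" using assms(1)[OF True] .
    have n: "1 \<le> real n" using True by simp
    have "real n * t n = real n powr 1 * t n" using n by simp
    also have "\<dots> = real n powr (1 + (\<beta> / 4 - 1 / 2))" unfolding t_def by (rule powr_add[symmetric])
    also have "\<dots> \<ge> 1" using n assms(2) by (intro ge_one_powr_ge_zero) auto
    finally have t: "1 \<le> real n * t n" .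
    have "real n * (t n)\<^sup>2 = real n powr 1 * (t n * t n)" using n by (simp add: power2_eq_square)
    also have "\<dots> = real n powr (1 + ((\<beta> / 4 - 1 / 2) + (\<beta> / 4 - 1 / 2)))"
      unfolding t_def by (simp only: powr_add)
    also have "1 + ((\<beta> / 4 - 1 / 2) + (\<beta> / 4 - 1 / 2)) = \<beta> / 2" by simp
    finally have sq: "real n * (t n)\<^sup>2 = real n powr (\<beta> / 2)" .
    \<comment> \<open>The factor 2 of Hoeffding's exponent pays for replacing \<open>n - 1\<close>
      by \<open>n\<close>.\<close>
    have "real n * (t n)\<^sup>2 \<le> 2 * (real n - 1) * (t n)\<^sup>2" using True by (intro mult_right_mono) auto
    then have "exp (- 2 * (real n - 1) * (t n)\<^sup>2) \<le> exp (- (real n powr (\<beta> / 2)))"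
      unfolding sq[symmetric] exp_le_cancel_iff by (simp add: algebra_simps)
    then have b: "2 * (real n + real Q0) * exp (- 2 * (real n - 1) * (t n)\<^sup>2) \<le> ?b n"
      by (intro mult_left_mono) auto
    have "0 \<le> t n" by (simp add: t_def)
    from S.concentration[OF t this] obtain A where A: "A \<in> sets M"
      "measure M A \<le> 2 * (real n + real Q0) * exp (- 2 * (real n - 1) * (t n)\<^sup>2)"
      "\<forall>\<omega>\<in>space M - A. good n \<omega>"
      unfolding good_def by blast
    then show ?thesis using order_trans[OF A(2) b] by blast
  qed auto
  then obtain E where E: "\<And>n. E n \<in> sets M" "\<And>n. 2 \<le> n \<Longrightarrow> measure M (E n) \<le> ?b n"
    "\<And>n \<omega>. 2 \<le> n \<Longrightarrow> \<omega> \<in> space M - E n \<Longrightarrow> good n \<omega>"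
    by metis
  have "summable (\<lambda>n. measure M (E n))"
  proof (rule summable_comparison_test_ev)
    show "summable ?b" using assms(2) by (intro summable_stretched_exp) simp
    show "\<forall>\<^sub>F n in sequentially. norm (measure M (E n)) \<le> ?b n"
      using eventually_ge_at_top[of 2] by eventually_elim (use E(2) in simp)
  qed
  then have "AE \<omega> in M. \<forall>\<^sub>F n in sequentially. \<omega> \<in> space M - E n"
    by (intro borel_cantelli_AE1 E(1)) (simp_all add: sbm2.emeasure_eq_measure)
  then show ?thesis
  proof eventually_elim
    case (elim \<omega>)
    then show ?case
      using eventually_ge_at_top[of 2] unfolding good_def[symmetric]
      by eventually_elim (use E(3) in blast)
  qed
qed

text \<open>The deterministic analysis along one sample path. The bounds are uniform over all
  \<open>Q\<close> in \<open>{2..n}\<close>, which a minimizer over a growing set of candidates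
  requires; convergence for each fixed \<open>Q\<close> would not suffice.\<close>

lemma eventually_criterion_bounds:
  fixes x :: "nat \<Rightarrow> nat \<Rightarrow> real" and z :: "nat \<Rightarrow> nat \<Rightarrow> nat" and C :: "nat \<Rightarrow> nat \<Rightarrow> nat \<Rightarrow> nat set"
  assumes \<alpha>: "\<And>q. q \<in> {1..Q0} \<Longrightarrow> 0 < \<alpha> q"
    and p: "\<And>q r. q \<in> {1..Q0} \<Longrightarrow> r \<in> {1..Q0} \<Longrightarrow> q \<noteq> r \<Longrightarrow> p q \<noteq> p r"
    and K: "0 < K" and t: "\<And>n. 2 \<le> n \<Longrightarrow> 0 < t n" "t \<longlonglongrightarrow> 0" "(\<lambda>n. real n powr ((1 - \<beta>) / 2) * t n) \<longlonglongrightarrow> 0"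
    and \<beta>: "\<beta> < 1"
    and good: "\<forall>\<^sub>F n in sequentially.
      (\<forall>i\<in>{1..n}. z n i \<in> {1..Q0} \<and> \<bar>x n i - p (z n i)\<bar> \<le> K * t n) \<and>
      (\<forall>q\<in>{1..Q0}. \<bar>real (card {i \<in> {1..n}. z n i = q}) - real n * \<alpha> q\<bar> \<le> real n * t n)"
    and C: "\<And>n Q. 2 \<le> n \<Longrightarrow> Q \<in> {2..n} \<Longrightarrow> lg_output n (x n) Q (C n Q)"
  shows "\<exists>c u v. 0 < c \<and> u \<longlonglongrightarrow> 0 \<and> filterlim v at_top sequentially \<and>
    (\<forall>\<^sub>F n in sequentially. \<forall>Q\<in>{2..n}.
      (Q < Q0 \<longrightarrow> ereal c \<le> lg_criterion \<beta> n (x n) Q (C n Q)) \<and>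
      (Q = Q0 \<longrightarrow> 0 \<le> lg_criterion \<beta> n (x n) Q (C n Q) \<and> lg_criterion \<beta> n (x n) Q (C n Q) \<le> ereal (u n)) \<and>
      (Q0 < Q \<longrightarrow> ereal (v n) \<le> lg_criterion \<beta> n (x n) Q (C n Q)))"
proof -
  have "\<exists>d>0. \<forall>x\<in>\<alpha> ` {1..Q0}. d \<le> x" by (rule finite_pos_lower_bound) (use \<alpha> in auto)
  then obtain a' where a': "0 < a'" "\<And>q. q \<in> {1..Q0} \<Longrightarrow> a' \<le> \<alpha> q" by blast
  \<comment> \<open>Halving leaves room for the error: once \<open>t n < a\<close>, every class
    keeps a proportion of at least \<open>a' - t n > a\<close>.\<close>
  define a where "a = a' / 2"
  let ?D = "(\<lambda>(q, r). \<bar>p q - p r\<bar>) ` {(q, r) \<in> {1..Q0} \<times> {1..Q0}. q \<noteq> r}"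
  have "finite ?D"
    by (rule finite_imageI, rule finite_subset[of _ "{1..Q0} \<times> {1..Q0}"]) auto
  then have "\<exists>d>0. \<forall>x\<in>?D. d \<le> x" by (rule finite_pos_lower_bound) (use p in auto)
  then obtain \<delta> where \<delta>: "0 < \<delta>" "\<And>d. d \<in> ?D \<Longrightarrow> \<delta> \<le> d" by blast
  have sep: "\<delta> \<le> \<bar>p q - p r\<bar>" if "q \<in> {1..Q0}" "r \<in> {1..Q0}" "q \<noteq> r" for q r
    using \<delta>(2)[of "\<bar>p q - p r\<bar>"] that by force
  define s where "s n = K * t n" for n
  let ?r = "\<lambda>n. real n powr ((1 - \<beta>) / 2)"
  \<comment> \<open>The sequences \<open>u\<close> and \<open>v\<close> are the bounds of
    \<open>criterion_exact\<close> and \<open>criterion_over\<close> with error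
    \<open>s n\<close>.\<close>
  define u where "u n = 4 * real Q0 * s n + 1 / (?r n * (\<delta> - 2 * s n))" for n
  define v where "v n = 1 / (?r n * (2 * s n))" for n
  have s0: "s \<longlonglongrightarrow> 0" unfolding s_def using tendsto_mult[OF tendsto_const t(2)] by simp
  have r_inf: "filterlim ?r at_top sequentially" using \<beta> by real_asymp
  have "(\<lambda>n. \<delta> - 2 * s n) \<longlonglongrightarrow> \<delta> - 2 * 0" by (intro tendsto_intros s0)
  then have "filterlim (\<lambda>n. (\<delta> - 2 * s n) * ?r n) at_top sequentially"
    using \<delta>(1) r_inf by (intro filterlim_tendsto_pos_mult_at_top[where c = \<delta>]) auto
  then have "(\<lambda>n. 1 / (?r n * (\<delta> - 2 * s n))) \<longlonglongrightarrow> 0"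
    by (subst mult.commute) (rule real_tendsto_divide_at_top[OF tendsto_const])
  then have "u \<longlonglongrightarrow> 4 * real Q0 * 0 + 0" unfolding u_def by (intro tendsto_intros s0)
  then have u: "u \<longlonglongrightarrow> 0" by simp
  have "(\<lambda>n. (2 * K) * (?r n * t n)) \<longlonglongrightarrow> (2 * K) * 0" by (intro tendsto_intros t(3))
  then have "(\<lambda>n. ?r n * (2 * s n)) \<longlonglongrightarrow> 0" by (simp add: s_def mult_ac)
  moreover have "\<forall>\<^sub>F n in sequentially. 0 < ?r n * (2 * s n)"
    using eventually_ge_at_top[of 2] by eventually_elim (use t(1) K in \<open>simp add: s_def\<close>)
  ultimately have "filterlim (\<lambda>n. inverse (?r n * (2 * s n))) at_top sequentially"
    by (intro filterlim_inverse_at_top)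
  then have v: "filterlim v at_top sequentially" unfolding v_def by (simp only: inverse_eq_divide)
  have ev: "\<forall>\<^sub>F n in sequentially. 4 * s n < \<delta>" "\<forall>\<^sub>F n in sequentially. t n < a"
    using order_tendstoD(2)[OF s0, of "\<delta> / 4"] order_tendstoD(2)[OF t(2), of a] \<delta>(1) a'(1)
    by (auto simp: a_def elim: eventually_mono)
  have "\<forall>\<^sub>F n in sequentially. \<forall>Q\<in>{2..n}.
      (Q < Q0 \<longrightarrow> ereal (a * (\<delta> / 2)) \<le> lg_criterion \<beta> n (x n) Q (C n Q)) \<and>
      (Q = Q0 \<longrightarrow> 0 \<le> lg_criterion \<beta> n (x n) Q (C n Q) \<and> lg_criterion \<beta> n (x n) Q (C n Q) \<le> ereal (u n)) \<and>
      (Q0 < Q \<longrightarrow> ereal (v n) \<le> lg_criterion \<beta> n (x n) Q (C n Q))"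
    using ev good eventually_ge_at_top[of 2]
  proof eventually_elim
    case (elim n)
    show ?case
    proof
      fix Q assume Q: "Q \<in> {2..n}"
      obtain \<sigma> \<iota> where lg: "is_ranking n (x n) \<sigma>" "lg_indices n (x n) Q \<iota>"
        "\<And>k. k \<in> {1..Q} \<Longrightarrow> C n Q k = \<sigma> ` {\<iota> (k - 1)<..\<iota> k}"
        using C[OF elim(4) Q] unfolding lg_output_def by blast
      have freq: "a * real n \<le> real (card {i \<in> {1..n}. z n i = q})" if q: "q \<in> {1..Q0}" for q
      proof -
        have "a * real n = (a' - a) * real n" by (simp add: a_def algebra_simps)
        also have "\<dots> \<le> (\<alpha> q - t n) * real n"
          using a'(2)[OF q] elim(2) by (intro mult_right_mono) auto
        also have "\<dots> = real n * \<alpha> q - real n * t n" by (simp add: algebra_simps)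
        also have "\<dots> \<le> real (card {i \<in> {1..n}. z n i = q})" using elim(3) q by fastforce
        finally show ?thesis .
      qed
      interpret lg_run_concentrated n "x n" Q "C n Q" \<sigma> \<iota> Q0 "z n" p \<delta> "s n" a
      proof
        show "0 < s n" using t(1)[OF elim(4)] K by (simp add: s_def)
        show "0 < a" using a'(1) by (simp add: a_def)
      qed (use lg Q elim(1,3) sep freq in \<open>auto simp: s_def\<close>)
      \<comment> \<open>Since \<open>4 * s n < \<delta>\<close>, the lower bound under merging is at
        least a constant independent of \<open>n\<close>.\<close>
      have "a * (\<delta> / 2) \<le> a * (\<delta> - 2 * s n)"
        using elim(1) a'(1) by (intro mult_left_mono) (auto simp: a_def)
      then have "ereal (a * (\<delta> / 2)) \<le> ereal (a * (\<delta> - 2 * s n))" by simp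
      then show "(Q < Q0 \<longrightarrow> ereal (a * (\<delta> / 2)) \<le> lg_criterion \<beta> n (x n) Q (C n Q)) \<and>
        (Q = Q0 \<longrightarrow> 0 \<le> lg_criterion \<beta> n (x n) Q (C n Q) \<and> lg_criterion \<beta> n (x n) Q (C n Q) \<le> ereal (u n)) \<and>
        (Q0 < Q \<longrightarrow> ereal (v n) \<le> lg_criterion \<beta> n (x n) Q (C n Q))"
        using order_trans[OF _ criterion_under[of \<beta>]] criterion_exact[of \<beta>] criterion_over[of \<beta>]
        unfolding u_def v_def by blast
    qed
  qed
  moreover have "0 < a * (\<delta> / 2)" using a'(1) \<delta>(1) by (simp add: a_def)
  ultimately show ?thesis using u v by blast
qed

theorem theorem6p5:
  fixes M :: "'a measure"
    and Q0 :: nat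
    and \<alpha> :: "nat \<Rightarrow> real"
    and \<pi> :: "nat \<Rightarrow> nat \<Rightarrow> real"
    and \<beta> :: real
    and Z :: "nat \<Rightarrow> 'a \<Rightarrow> nat \<Rightarrow> nat"
    and X :: "nat \<Rightarrow> 'a \<Rightarrow> nat \<Rightarrow> nat \<Rightarrow> bool"
    and T :: "nat \<Rightarrow> 'a \<Rightarrow> nat \<Rightarrow> real"
    and C :: "nat \<Rightarrow> nat \<Rightarrow> 'a \<Rightarrow> nat \<Rightarrow> nat set"
    and f :: "nat \<Rightarrow> nat \<Rightarrow> 'a \<Rightarrow> ereal"
  assumes "prob_space M"
    and "Q0 \<ge> 2"
    and "\<forall>q\<in>{1..Q0}. \<alpha> q > 0"
    and "(\<Sum>q=1..Q0. \<alpha> q) = 1"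
    and "\<forall>q\<in>{1..Q0}. \<forall>r\<in>{1..Q0}. \<pi> q r = \<pi> r q \<and> 0 \<le> \<pi> q r \<and> \<pi> q r \<le> 1"
    and "\<forall>q\<in>{1..Q0}. \<forall>r\<in>{1..Q0}. q \<noteq> r \<longrightarrow>
           (\<Sum>s=1..Q0. \<alpha> s * \<pi> q s) \<noteq> (\<Sum>s=1..Q0. \<alpha> s * \<pi> r s)"
    and "\<forall>n\<ge>2. stochastic_block_model M n Q0 \<pi> \<alpha> (Z n) (X n)"
    and "0 < \<beta>" and "\<beta> < 1"
    and "\<forall>n \<omega>. T n \<omega> = norm_degree n (X n \<omega>)"
    and "\<forall>n\<ge>2. \<forall>Q\<in>{2..n}. \<forall>\<omega>\<in>space M. lg_output n (T n \<omega>) Q (C n Q \<omega>)"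
    and "\<forall>n Q \<omega>. f n Q \<omega> = lg_criterion \<beta> n (T n \<omega>) Q (C n Q \<omega>)"
  shows "(\<forall>Q\<ge>2.
            (Q = Q0 \<longrightarrow> (AE \<omega> in M. (\<lambda>n. f n Q \<omega>) \<longlonglongrightarrow> 0)) \<and>
            (Q < Q0 \<longrightarrow> (AE \<omega> in M. liminf (\<lambda>n. f n Q \<omega>) > 0)) \<and>
            (Q > Q0 \<longrightarrow> (AE \<omega> in M. (\<lambda>n. f n Q \<omega>) \<longlonglongrightarrow> \<infinity>))) \<and>
         (\<forall>Qhat :: nat \<Rightarrow> 'a \<Rightarrow> nat.
            (\<forall>n\<ge>2. \<forall>\<omega>\<in>space M.
               is_arg_min (\<lambda>Q. f n Q \<omega>) (\<lambda>Q. Q \<in> {2..n}) (Qhat n \<omega>)) \<longrightarrow>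
            (AE \<omega> in M. (\<lambda>n. real (Qhat n \<omega>)) \<longlonglongrightarrow> real Q0))"
proof -
  define p where "p q = (\<Sum>r = 1..Q0. \<alpha> r * \<pi> q r)" for q
  define t where "t n = real n powr (\<beta> / 4 - 1 / 2)" for n
  have sbm: "sbm M n Q0 \<pi> \<alpha> (Z n) (X n)" if "2 \<le> n" for n
    using assms(1,3,4,5,7) that by (simp add: sbm_def sbm_axioms_def less_imp_le)
  have t: "t \<longlonglongrightarrow> 0" "(\<lambda>n. real n powr ((1 - \<beta>) / 2) * t n) \<longlonglongrightarrow> 0"
  proof -
    show "t \<longlonglongrightarrow> 0" unfolding t_def using assms(9) by real_asymp
    have "(\<lambda>n. real n powr (- (\<beta> / 4))) \<longlonglongrightarrow> 0" using assms(8) by real_asymp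
    \<comment> \<open>The exponents add up to \<open>- (\<beta> / 4)\<close>, which is where
      positivity of \<open>\<beta>\<close> enters.\<close>
    moreover have "real n powr ((1 - \<beta>) / 2) * t n = real n powr (- (\<beta> / 4))" for n
      by (simp add: t_def field_simps flip: powr_add)
    ultimately show "(\<lambda>n. real n powr ((1 - \<beta>) / 2) * t n) \<longlonglongrightarrow> 0" by simp
  qed
  have concentrated: "AE \<omega> in M. \<forall>\<^sub>F n in sequentially.
    (\<forall>i\<in>{1..n}. Z n \<omega> i \<in> {1..Q0} \<and>
      \<bar>norm_degree n (X n \<omega>) i - p (Z n \<omega> i)\<bar> \<le> (2 * real Q0 + 3) * t n) \<and>
    (\<forall>q\<in>{1..Q0}. \<bar>real (card {i \<in> {1..n}. Z n \<omega> i = q}) - real n * \<alpha> q\<bar> \<le> real n * t n)"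
    unfolding p_def t_def by (rule AE_sbm_concentrated) (use sbm assms(8) in auto)
  \<comment> \<open>The constants \<open>c\<close>, \<open>u\<close>, \<open>v\<close> may depend on
    the sample path. All four almost sure claims are read off from this one property.\<close>
  define bounded where "bounded \<omega> c u v \<longleftrightarrow> (\<forall>\<^sub>F n in sequentially. \<forall>Q\<in>{2..n}.
      (Q < Q0 \<longrightarrow> ereal c \<le> f n Q \<omega>) \<and>
      (Q = Q0 \<longrightarrow> 0 \<le> f n Q \<omega> \<and> f n Q \<omega> \<le> ereal (u n)) \<and> (Q0 < Q \<longrightarrow> ereal (v n) \<le> f n Q \<omega>))" for \<omega> c u v
  have bounds: "AE \<omega> in M. \<exists>c u v. 0 < c \<and> u \<longlonglongrightarrow> 0 \<and> filterlim v at_top sequentially \<and> bounded \<omega> c u v"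
    using concentrated AE_space
  proof eventually_elim
    case (elim \<omega>)
    have good: "\<forall>\<^sub>F n in sequentially.
        (\<forall>i\<in>{1..n}. Z n \<omega> i \<in> {1..Q0} \<and> \<bar>T n \<omega> i - p (Z n \<omega> i)\<bar> \<le> (2 * real Q0 + 3) * t n) \<and>
        (\<forall>q\<in>{1..Q0}. \<bar>real (card {i \<in> {1..n}. Z n \<omega> i = q}) - real n * \<alpha> q\<bar> \<le> real n * t n)"
      using elim(1) assms(10) by simp
    have "\<exists>c u v. 0 < c \<and> u \<longlonglongrightarrow> 0 \<and> filterlim v at_top sequentially \<and>
    (\<forall>\<^sub>F n in sequentially. \<forall>Q\<in>{2..n}.
      (Q < Q0 \<longrightarrow> ereal c \<le> lg_criterion \<beta> n (T n \<omega>) Q (C n Q \<omega>)) \<and>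
      (Q = Q0 \<longrightarrow> 0 \<le> lg_criterion \<beta> n (T n \<omega>) Q (C n Q \<omega>) \<and> lg_criterion \<beta> n (T n \<omega>) Q (C n Q \<omega>) \<le> ereal (u n)) \<and>
      (Q0 < Q \<longrightarrow> ereal (v n) \<le> lg_criterion \<beta> n (T n \<omega>) Q (C n Q \<omega>)))"
      by (rule eventually_criterion_bounds[OF _ _ _ _ t assms(9) good])
        (use assms elim(2) in \<open>auto simp: p_def t_def\<close>)
    then show ?case using assms(12) by (simp add: bounded_def)
  qed
  have exact: "AE \<omega> in M. (\<lambda>n. f n Q0 \<omega>) \<longlonglongrightarrow> 0"
    using bounds
  proof eventually_elim
    case (elim \<omega>)
    then obtain c u v where c: "0 < c" and u: "u \<longlonglongrightarrow> 0" and v: "filterlim v at_top sequentially"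
      and "bounded \<omega> c u v"
      by blast
    note ev = this(4)[unfolded bounded_def]
    have lower: "\<forall>\<^sub>F n in sequentially. 0 \<le> f n Q0 \<omega>"
      using ev eventually_ge_at_top[of Q0] by eventually_elim (use assms(2) in simp)
    have upper: "\<forall>\<^sub>F n in sequentially. f n Q0 \<omega> \<le> ereal (u n)"
      using ev eventually_ge_at_top[of Q0] by eventually_elim (use assms(2) in simp)
    have "(\<lambda>n. ereal (u n)) \<longlonglongrightarrow> 0" using u by (simp add: zero_ereal_def)
    then show ?case by (rule tendsto_sandwich[OF lower upper tendsto_const])
  qed
  have under: "AE \<omega> in M. liminf (\<lambda>n. f n Q \<omega>) > 0" if Q: "2 \<le> Q" "Q < Q0" for Q
    using bounds
  proof eventually_elim
    case (elim \<omega>)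
    then obtain c u v where c: "0 < c" and u: "u \<longlonglongrightarrow> 0" and v: "filterlim v at_top sequentially"
      and "bounded \<omega> c u v"
      by blast
    note ev = this(4)[unfolded bounded_def]
    have "\<forall>\<^sub>F n in sequentially. ereal c \<le> f n Q \<omega>"
      using ev eventually_ge_at_top[of Q] by eventually_elim (use Q in simp)
    then have "ereal c \<le> liminf (\<lambda>n. f n Q \<omega>)" by (rule Liminf_bounded)
    moreover have "0 < ereal c" using c by simp
    ultimately show ?case by (rule less_le_trans[rotated])
  qed
  have over: "AE \<omega> in M. (\<lambda>n. f n Q \<omega>) \<longlonglongrightarrow> \<infinity>" if Q: "Q0 < Q" for Q
    using bounds
  proof eventually_elim
    case (elim \<omega>)
    then obtain c u v where c: "0 < c" and u: "u \<longlonglongrightarrow> 0" and v: "filterlim v at_top sequentially"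
      and "bounded \<omega> c u v"
      by blast
    note ev = this(4)[unfolded bounded_def]
    show ?case
      unfolding tendsto_PInfty
    proof
      fix r
      have "\<forall>\<^sub>F n in sequentially. r < v n" using v by (simp add: filterlim_at_top_dense)
      then show "\<forall>\<^sub>F n in sequentially. ereal r < f n Q \<omega>"
        using ev eventually_ge_at_top[of Q]
      proof eventually_elim
        case (elim n)
        then have "ereal r < ereal (v n)" "ereal (v n) \<le> f n Q \<omega>" using Q assms(2) by auto
        then show ?case by (rule less_le_trans)
      qed
    qed
  qed
  have argmin: "AE \<omega> in M. (\<lambda>n. real (Qhat n \<omega>)) \<longlonglongrightarrow> real Q0"
    if Qhat: "\<forall>n\<ge>2. \<forall>\<omega>\<in>space M. is_arg_min (\<lambda>Q. f n Q \<omega>) (\<lambda>Q. Q \<in> {2..n}) (Qhat n \<omega>)"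
    for Qhat :: "nat \<Rightarrow> 'a \<Rightarrow> nat"
    using bounds AE_space
  proof eventually_elim
    case (elim \<omega>)
    then obtain c u v where c: "0 < c" and u: "u \<longlonglongrightarrow> 0" and v: "filterlim v at_top sequentially"
      and "bounded \<omega> c u v"
      by blast
    note ev = this(4)[unfolded bounded_def]
    have "\<forall>\<^sub>F n in sequentially. u n < c" using order_tendstoD(2)[OF u c] .
    moreover have "\<forall>\<^sub>F n in sequentially. c < v n" using v by (simp add: filterlim_at_top_dense)
    \<comment> \<open>Once \<open>u n < c < v n\<close>, the value at \<open>Q0\<close> lies
      strictly below the value at every other candidate, so every minimizer equals
      \<open>Q0\<close>.\<close>
    ultimately have "\<forall>\<^sub>F n in sequentially. Qhat n \<omega> = Q0"
      using ev eventually_ge_at_top[of Q0]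
    proof eventually_elim
      case (elim n)
      have n: "2 \<le> n" "Q0 \<in> {2..n}" using elim(4) assms(2) by auto
      have min: "Qhat n \<omega> \<in> {2..n}" "\<not> f n Q0 \<omega> < f n (Qhat n \<omega>) \<omega>"
        using Qhat n \<open>\<omega> \<in> space M\<close> by (auto simp: is_arg_min_def)
      have Q0: "f n Q0 \<omega> \<le> ereal (u n)" using elim(3) n(2) by blast
      show ?case
      proof (rule ccontr)
        assume "Qhat n \<omega> \<noteq> Q0"
        then consider "Qhat n \<omega> < Q0" | "Q0 < Qhat n \<omega>" by linarith
        then have "ereal (u n) < f n (Qhat n \<omega>) \<omega>"
        proof cases
          case 1
          then have "ereal c \<le> f n (Qhat n \<omega>) \<omega>" using elim(3) min(1) by blast
          moreover have "ereal (u n) < ereal c" using elim(1) by simp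
          ultimately show ?thesis by (rule less_le_trans[rotated])
        next
          case 2
          then have "ereal (v n) \<le> f n (Qhat n \<omega>) \<omega>" using elim(3) min(1) by blast
          moreover have "ereal (u n) < ereal (v n)" using elim(1,2) by simp
          ultimately show ?thesis by (rule less_le_trans[rotated])
        qed
        with Q0 have "f n Q0 \<omega> < f n (Qhat n \<omega>) \<omega>" by (rule le_less_trans)
        then show False using min(2) by simp
      qed
    qed
    then have "\<forall>\<^sub>F n in sequentially. real (Qhat n \<omega>) = real Q0" by eventually_elim simp
    then show ?case by (rule tendsto_eventually)
  qed
  show ?thesis using exact under over argmin by simp
qed

end
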